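(* Let $G$ be a reductive group over an algebraically closed field $\Bbbk$ of arbitrary characteristic. Then $\sigma(G)$ is finite if and only if $G$ is finite.
   Context: Reductive groups are linear algebraic groups and need not be connected. A $G$-module is a finite-dimensional rational representation $V$ of $G$ over $\Bbbk$. $\Bbbk[V]\cong S(V^* )$ is the ring of polynomial functions on $V$, with $G$-action $(g\cdot f)(v)=f(g^{-1}v)$ and invariant ring $\Bbbk[V]^G$, graded by degree. $\Bbbk[V]^G_{\le d}$ is the set of invariants of degree at most $d$. For $S\subseteq \Bbbk[V]$, $S_+$ is the set of elements of $S$ with constant term zero. The nullcone $\mathcal{N}_{G,V}\subseteq V$ is the common zero set of $\Bbbk[V]^G_+$. A subset $S\subseteq\Bbbk[V]^G$ is a $\sigma$-set if for every $v\in V\setminus\mathcal{N}_{G,V}$ there is $f\in S_+$ with $f(v)\neq 0$. Define $\sigma(G,V)=\min\{d\ge 0 : \Bbbk[V]^G_{\le d}\text{ is a }\sigma\text{-set}\}$ and $\sigma(G)=\sup\{\sigma(G,V): V\text{ a }G\text{-module}\}$ (equal to $\infty$ if unbounded). *)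

theory Defs
  imports
    "Jordan_Normal_Form.Determinant"
    "HOL-Library.Extended_Nat"
    "HOL-Algebra.Coset"
    "HOL-Analysis.Abstract_Topology"
    "HOL-Library.Poly_Mapping"
begin

section \<open>Polynomials in several variables\<close>

text \<open>
  A polynomial with variables indexed by \<^typ>\<open>'i\<close> is a finitely supported family of coefficients
  indexed by monomials, and a monomial is a finitely supported family of exponents.
\<close>

type_synonym ('i, 'a) mpoly = "('i \<Rightarrow>\<^sub>0 nat) \<Rightarrow>\<^sub>0 'a"

definition mpolys :: "'i set \<Rightarrow> ('i, 'a::zero) mpoly set" where
  "mpolys I = {p. \<forall>t\<in>Poly_Mapping.keys p. Poly_Mapping.keys t \<subseteq> I}"

definition mon_eval :: "('i \<Rightarrow>\<^sub>0 nat) \<Rightarrow> ('i \<Rightarrow> 'a::comm_semiring_1) \<Rightarrow> 'a" where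
  "mon_eval t x = (\<Prod>i\<in>Poly_Mapping.keys t. x i ^ Poly_Mapping.lookup t i)"

definition mpoly_eval :: "('i, 'a::comm_semiring_1) mpoly \<Rightarrow> ('i \<Rightarrow> 'a) \<Rightarrow> 'a" where
  "mpoly_eval p x = (\<Sum>t\<in>Poly_Mapping.keys p. Poly_Mapping.lookup p t * mon_eval t x)"

text \<open>The zero polynomial gets total degree 0.\<close>

definition total_degree :: "('i, 'a::zero) mpoly \<Rightarrow> nat" where
  "total_degree p =
     Max (insert 0 ((\<lambda>t. \<Sum>i\<in>Poly_Mapping.keys t. Poly_Mapping.lookup t i) ` Poly_Mapping.keys p))"

abbreviation const_term :: "('i, 'a::zero) mpoly \<Rightarrow> 'a" where
  "const_term p \<equiv> Poly_Mapping.lookup p 0"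

lemma mon_eval_superset:
  assumes "finite I" "Poly_Mapping.keys t \<subseteq> I"
  shows "mon_eval t x = (\<Prod>i\<in>I. x i ^ Poly_Mapping.lookup t i)"
  unfolding mon_eval_def
  by (rule prod.mono_neutral_left) (use assms in \<open>auto simp: in_keys_iff\<close>)

lemma mon_eval_0 [simp]: "mon_eval 0 x = 1"
  by (simp add: mon_eval_def)

lemma mon_eval_add: "mon_eval (s + t) x = mon_eval s x * mon_eval t x"
proof -
  let ?I = "Poly_Mapping.keys s \<union> Poly_Mapping.keys t"
  have "mon_eval (s + t) x = (\<Prod>i\<in>?I. x i ^ Poly_Mapping.lookup (s + t) i)"
    by (rule mon_eval_superset) (auto dest: set_mp[OF keys_add])
  also have "\<dots> = (\<Prod>i\<in>?I. x i ^ Poly_Mapping.lookup s i) * (\<Prod>i\<in>?I. x i ^ Poly_Mapping.lookup t i)"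
    by (simp add: lookup_add power_add prod.distrib)
  also have "\<dots> = mon_eval s x * mon_eval t x"
    by (subst (1 2) mon_eval_superset[of ?I]) auto
  finally show ?thesis .
qed

lemma mpoly_eval_superset:
  assumes "finite S" "Poly_Mapping.keys p \<subseteq> S"
  shows "mpoly_eval p x = (\<Sum>t\<in>S. Poly_Mapping.lookup p t * mon_eval t x)"
  unfolding mpoly_eval_def
  by (rule sum.mono_neutral_left) (use assms in \<open>auto simp: in_keys_iff\<close>)

lemma mpoly_eval_0 [simp]: "mpoly_eval 0 x = 0"
  by (simp add: mpoly_eval_def)

lemma mpoly_eval_1 [simp]: "mpoly_eval 1 x = 1"
  by (simp add: mpoly_eval_def)

lemma mpoly_eval_single [simp]: "mpoly_eval (Poly_Mapping.single t c) x = c * mon_eval t x"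
  by (subst mpoly_eval_superset[of "{t}"]) auto

lemma mpoly_eval_add: "mpoly_eval (p + q) x = mpoly_eval p x + mpoly_eval q x"
proof -
  let ?S = "Poly_Mapping.keys p \<union> Poly_Mapping.keys q"
  have "mpoly_eval (p + q) x = (\<Sum>t\<in>?S. Poly_Mapping.lookup (p + q) t * mon_eval t x)"
    by (rule mpoly_eval_superset) (auto dest: set_mp[OF keys_add])
  also have "\<dots> = (\<Sum>t\<in>?S. Poly_Mapping.lookup p t * mon_eval t x)
      + (\<Sum>t\<in>?S. Poly_Mapping.lookup q t * mon_eval t x)"
    by (simp add: lookup_add algebra_simps sum.distrib)
  also have "\<dots> = mpoly_eval p x + mpoly_eval q x"
    by (subst (1 2) mpoly_eval_superset[of ?S]) auto
  finally show ?thesis .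
qed

lemma mpoly_eval_sum: "mpoly_eval (\<Sum>a\<in>A. f a) x = (\<Sum>a\<in>A. mpoly_eval (f a) x)"
  by (induction A rule: infinite_finite_induct) (auto simp: mpoly_eval_add)

lemma mpoly_expand:
  "(\<Sum>t\<in>Poly_Mapping.keys p. Poly_Mapping.single t (Poly_Mapping.lookup p t))
     = (p :: ('i, 'a::comm_monoid_add) mpoly)"
  by (rule poly_mapping_eqI) (auto simp: lookup_sum lookup_single when_def in_keys_iff)

lemma mpoly_eval_mult: "mpoly_eval (p * q) x = mpoly_eval p x * mpoly_eval q x"
proof -
  let ?m = "\<lambda>p t. Poly_Mapping.single t (Poly_Mapping.lookup p t)"
  have "p * q = (\<Sum>s\<in>Poly_Mapping.keys p. \<Sum>t\<in>Poly_Mapping.keys q. ?m p s * ?m q t)"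
    by (simp add: sum_product[symmetric] mpoly_expand)
  then have "mpoly_eval (p * q) x =
      (\<Sum>s\<in>Poly_Mapping.keys p. \<Sum>t\<in>Poly_Mapping.keys q.
        Poly_Mapping.lookup p s * Poly_Mapping.lookup q t * (mon_eval s x * mon_eval t x))"
    by (simp add: mpoly_eval_sum mult_single mon_eval_add)
  also have "\<dots> = mpoly_eval p x * mpoly_eval q x"
    by (simp add: mpoly_eval_def sum_product ac_simps)
  finally show ?thesis .
qed

lemma mpolys_1: "1 \<in> mpolys I"
  by (simp add: mpolys_def)

lemma mpolys_mult:
  assumes "p \<in> mpolys I" "q \<in> mpolys I"
  shows "p * q \<in> mpolys I"
  unfolding mpolys_def
proof clarify
  fix t i assume "t \<in> Poly_Mapping.keys (p * q)" and i: "i \<in> Poly_Mapping.keys t"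
  then obtain a b where "a \<in> Poly_Mapping.keys p" "b \<in> Poly_Mapping.keys q" "t = a + b"
    using keys_mult[of p q] by auto
  with i assms show "i \<in> I"
    using keys_add[of a b] unfolding mpolys_def by blast
qed

section \<open>Linear algebraic groups\<close>

definition GL :: "nat \<Rightarrow> 'a::field mat monoid" where
  "GL n = units_of (ring_mat TYPE('a) n ())"

lemma carrier_GL: "carrier (GL n) = {A \<in> carrier_mat n n. det A \<noteq> 0}"
proof (intro equalityI subsetI)
  fix A :: "'a mat" assume A: "A \<in> carrier (GL n)"
  then have "A \<in> carrier_mat n n"
    by (simp add: GL_def units_of_carrier Units_def ring_mat_simps)
  with A show "A \<in> {A \<in> carrier_mat n n. det A \<noteq> 0}"
    unfolding GL_def units_of_carrier using unit_imp_det_non_zero[of A n "()"] by blast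
next
  fix A :: "'a mat" assume "A \<in> {A \<in> carrier_mat n n. det A \<noteq> 0}"
  then show "A \<in> carrier (GL n)"
    unfolding GL_def units_of_carrier using det_non_zero_imp_unit[of A n "()"] by blast
qed

lemma group_GL: "group (GL n)"
  unfolding GL_def by (intro monoid.units_group ring.is_monoid ring_mat)

abbreviation matrix_polys :: "nat \<Rightarrow> (nat \<times> nat, 'a::field) mpoly set" where
  "matrix_polys n \<equiv> mpolys ({..<n} \<times> {..<n})"

abbreviation eval_mat :: "(nat \<times> nat, 'a::field) mpoly \<Rightarrow> 'a mat \<Rightarrow> 'a" where
  "eval_mat p A \<equiv> mpoly_eval p (\<lambda>ij. A $$ ij)"

definition zariski_open :: "nat \<Rightarrow> 'a::field mat set \<Rightarrow> bool" where
  "zariski_open n U \<longleftrightarrow>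
     (\<exists>F \<subseteq> matrix_polys n. U = {A \<in> carrier (GL n). \<exists>p\<in>F. eval_mat p A \<noteq> 0})"

definition zariski_GL :: "nat \<Rightarrow> 'a::field mat topology" where
  "zariski_GL n = topology (zariski_open n)"

lemma istopology_zariski: "istopology (zariski_open n)"
  unfolding istopology_def
proof (intro conjI allI impI)
  fix S T :: "'a mat set"
  assume "zariski_open n S" "zariski_open n T"
  then obtain F H where F: "F \<subseteq> matrix_polys n" "S = {A \<in> carrier (GL n). \<exists>p\<in>F. eval_mat p A \<noteq> 0}"
    and H: "H \<subseteq> matrix_polys n" "T = {A \<in> carrier (GL n). \<exists>p\<in>H. eval_mat p A \<noteq> 0}"
    unfolding zariski_open_def by auto
  let ?K = "(\<lambda>(p, q). p * q) ` (F \<times> H)"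
  have "?K \<subseteq> matrix_polys n"
    using F(1) H(1) by (auto intro!: mpolys_mult)
  moreover have "S \<inter> T = {A \<in> carrier (GL n). \<exists>p\<in>?K. eval_mat p A \<noteq> 0}"
    unfolding F(2) H(2) by (auto simp: mpoly_eval_mult)
  ultimately show "zariski_open n (S \<inter> T)"
    unfolding zariski_open_def by blast
next
  fix K :: "'a mat set set"
  assume "\<forall>U\<in>K. zariski_open n U"
  define D where "D F = {A \<in> carrier (GL n). \<exists>p\<in>F. eval_mat p A \<noteq> 0}"
    for F :: "(nat \<times> nat, 'a) mpoly set"
  have "\<forall>U\<in>K. \<exists>F. F \<subseteq> matrix_polys n \<and> U = D F"
    using \<open>\<forall>U\<in>K. zariski_open n U\<close> by (simp add: zariski_open_def D_def)
  from bchoice[OF this] obtain F where F: "\<forall>U\<in>K. F U \<subseteq> matrix_polys n \<and> U = D (F U)" ..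
  then have "\<Union>K = (\<Union>U\<in>K. D (F U))"
    by auto
  also have "\<dots> = D (\<Union>(F ` K))"
    by (auto simp: D_def)
  finally have "\<Union>K = D (\<Union>(F ` K))" .
  moreover have "\<Union>(F ` K) \<subseteq> matrix_polys n"
    using F by (simp add: UN_subset_iff)
  ultimately show "zariski_open n (\<Union>K)"
    unfolding zariski_open_def D_def by blast
qed

lemma openin_zariski: "openin (zariski_GL n) = zariski_open n"
  by (simp add: zariski_GL_def topology_inverse' istopology_zariski)

lemma topspace_zariski: "topspace (zariski_GL n) = carrier (GL n)"
proof -
  have "zariski_open n (carrier (GL n) :: 'a mat set)"
    unfolding zariski_open_def by (rule exI[of _ "{1}"]) (auto simp: mpolys_1)
  moreover have "U \<subseteq> carrier (GL n)" if "zariski_open n U" for U :: "'a mat set"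
    using that by (auto simp: zariski_open_def)
  ultimately show ?thesis
    unfolding topspace_def openin_zariski by blast
qed

lemma closedin_zariski:
  "closedin (zariski_GL n) X \<longleftrightarrow>
     (\<exists>F \<subseteq> matrix_polys n. X = {A \<in> carrier (GL n). \<forall>p\<in>F. eval_mat p A = 0})"
proof
  assume "closedin (zariski_GL n) X"
  then obtain F where "X \<subseteq> carrier (GL n)" "F \<subseteq> matrix_polys n"
    "carrier (GL n) - X = {A \<in> carrier (GL n). \<exists>p\<in>F. eval_mat p A \<noteq> 0}"
    unfolding closedin_def openin_zariski topspace_zariski zariski_open_def by blast
  moreover from this have "X = {A \<in> carrier (GL n). \<forall>p\<in>F. eval_mat p A = 0}"
    by blast
  ultimately show "\<exists>F \<subseteq> matrix_polys n. X = {A \<in> carrier (GL n). \<forall>p\<in>F. eval_mat p A = 0}"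
    by blast
next
  assume "\<exists>F \<subseteq> matrix_polys n. X = {A \<in> carrier (GL n). \<forall>p\<in>F. eval_mat p A = 0}"
  then obtain F where F: "F \<subseteq> matrix_polys n"
    "X = {A \<in> carrier (GL n). \<forall>p\<in>F. eval_mat p A = 0}" by blast
  then have "carrier (GL n) - X = {A \<in> carrier (GL n). \<exists>p\<in>F. eval_mat p A \<noteq> 0}"
    by blast
  with F show "closedin (zariski_GL n) X"
    unfolding closedin_def openin_zariski topspace_zariski zariski_open_def by blast
qed

definition linear_algebraic_group :: "nat \<Rightarrow> 'a::field mat set \<Rightarrow> bool" where
  "linear_algebraic_group n G \<longleftrightarrow> subgroup G (GL n) \<and> closedin (zariski_GL n) G"

definition unipotent :: "nat \<Rightarrow> 'a::field mat \<Rightarrow> bool" where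
  "unipotent n A \<longleftrightarrow> (\<exists>k. (A - 1\<^sub>m n) ^\<^sub>m k = 0\<^sub>m n n)"

text \<open>
  The closed connected normal unipotent subgroups of a linear algebraic group have a largest member,
  the unipotent radical; it is therefore their union.
\<close>

definition unipotent_radical :: "nat \<Rightarrow> 'a::field mat set \<Rightarrow> 'a mat set" where
  "unipotent_radical n G =
     \<Union>{N. N \<lhd> (GL n)\<lparr>carrier := G\<rparr> \<and> closedin (zariski_GL n) N \<and> connectedin (zariski_GL n) N
          \<and> (\<forall>A\<in>N. unipotent n A)}"

definition reductive_group :: "nat \<Rightarrow> 'a::field mat set \<Rightarrow> bool" where
  "reductive_group n G \<longleftrightarrow> linear_algebraic_group n G \<and> unipotent_radical n G = {1\<^sub>m n}"

section \<open>Modules and invariants\<close>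

text \<open>
  The coordinate ring of \<open>GL n\<close> consists of the functions \<open>p / det ^ r\<close>, and every regular function
  on a closed subset of \<open>GL n\<close> is the restriction of one of these.
\<close>

definition regular_on :: "nat \<Rightarrow> 'a::field mat set \<Rightarrow> ('a mat \<Rightarrow> 'a) \<Rightarrow> bool" where
  "regular_on n G f \<longleftrightarrow>
     (\<exists>p\<in>matrix_polys n. \<exists>r. \<forall>A\<in>G. f A = eval_mat p A / det A ^ r)"

text \<open>
  A \<open>G\<close>-module, after the choice of a basis: \<open>V\<close> is the space of column vectors of length \<open>m\<close>.
\<close>

definition G_module :: "nat \<Rightarrow> 'a::field mat set \<Rightarrow> nat \<Rightarrow> ('a mat \<Rightarrow> 'a mat) \<Rightarrow> bool" where
  "G_module n G m \<rho> \<longleftrightarrow> \<rho> \<in> hom ((GL n)\<lparr>carrier := G\<rparr>) (GL m) \<and>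
     (\<forall>i<m. \<forall>j<m. regular_on n G (\<lambda>g. \<rho> g $$ (i, j)))"

text \<open>
  The ring of polynomial functions on \<open>V\<close> is \<open>mpolys {..<m}\<close>; over an infinite field a polynomial
  is determined by its values on \<open>V\<close>, so the action on polynomial functions is described pointwise.
\<close>

abbreviation eval_vec :: "(nat, 'a::field) mpoly \<Rightarrow> 'a vec \<Rightarrow> 'a" where
  "eval_vec f v \<equiv> mpoly_eval f (\<lambda>i. v $ i)"

definition invariants ::
  "nat \<Rightarrow> 'a::field mat set \<Rightarrow> nat \<Rightarrow> ('a mat \<Rightarrow> 'a mat) \<Rightarrow> (nat, 'a) mpoly set" where
  "invariants n G m \<rho> = {f \<in> mpolys {..<m}. \<forall>g\<in>G. \<forall>v\<in>carrier_vec m.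
     eval_vec f (\<rho> (inv\<^bsub>GL n\<^esub> g) *\<^sub>v v) = eval_vec f v}"

definition invariants_le ::
  "nat \<Rightarrow> 'a::field mat set \<Rightarrow> nat \<Rightarrow> ('a mat \<Rightarrow> 'a mat) \<Rightarrow> nat \<Rightarrow> (nat, 'a) mpoly set" where
  "invariants_le n G m \<rho> d = {f \<in> invariants n G m \<rho>. total_degree f \<le> d}"

definition plus_part :: "('i, 'a::zero) mpoly set \<Rightarrow> ('i, 'a) mpoly set" where
  "plus_part S = {f \<in> S. const_term f = 0}"

definition nullcone ::
  "nat \<Rightarrow> 'a::field mat set \<Rightarrow> nat \<Rightarrow> ('a mat \<Rightarrow> 'a mat) \<Rightarrow> 'a vec set" where
  "nullcone n G m \<rho> =
     {v \<in> carrier_vec m. \<forall>f\<in>plus_part (invariants n G m \<rho>). eval_vec f v = 0}"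

definition sigma_set ::
  "nat \<Rightarrow> 'a::field mat set \<Rightarrow> nat \<Rightarrow> ('a mat \<Rightarrow> 'a mat) \<Rightarrow> (nat, 'a) mpoly set \<Rightarrow> bool" where
  "sigma_set n G m \<rho> S \<longleftrightarrow> S \<subseteq> invariants n G m \<rho> \<and>
     (\<forall>v\<in>carrier_vec m - nullcone n G m \<rho>. \<exists>f\<in>plus_part S. eval_vec f v \<noteq> 0)"

text \<open>
  By Hilbert's basis theorem some \<open>d\<close> always qualifies, so that the infimum is a minimum.
\<close>

definition sigma_module ::
  "nat \<Rightarrow> 'a::field mat set \<Rightarrow> nat \<Rightarrow> ('a mat \<Rightarrow> 'a mat) \<Rightarrow> enat" where
  "sigma_module n G m \<rho> = Inf {enat d |d. sigma_set n G m \<rho> (invariants_le n G m \<rho> d)}"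

definition sigma :: "nat \<Rightarrow> 'a::field mat set \<Rightarrow> enat" where
  "sigma n G = Sup {sigma_module n G m \<rho> |m \<rho>. G_module n G m \<rho>}"

end

theory Submission
  imports Defs "HOL-Library.Product_Lexorder" "HOL-Analysis.Abstract_Topology_2"
    "Jordan_Normal_Form.Char_Poly"
begin

text \<open>
  If \<open>G\<close> is finite, the norm of a generic linear form is an invariant of degree \<open>card G\<close> that does
  not vanish at a given nonzero vector.

  Let \<open>G\<close> be infinite. By Noetherianity its identity component \<open>C\<close> is infinite. If the
  eigenvalues of all elements of \<open>G\<close> had bounded order, only finitely many characteristic polynomials
  would occur, so by connectedness all elements of \<open>C\<close> would have that of the identity; then \<open>C\<close>
  would be contained in the unipotent radical. Hence for every \<open>d\<close> some \<open>g\<close> in \<open>G\<close> has an eigenvalue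
  \<open>t\<close> of order greater than \<open>d\<^sup>2\<close>. On the sum of the natural module \<open>W\<close> and the \<open>d\<close>-th tensor power
  of its dual, take \<open>w\<close> an eigenvector of \<open>g\<close> for \<open>t\<close>, and the \<open>d\<close>-th power of a functional \<open>l\<close>
  in the generalized eigenspace for the inverse of \<open>t\<close>, with \<open>l(w)\<close> nonzero. The natural pairing, an
  invariant of degree \<open>d + 1\<close>, does not vanish there. An invariant \<open>f\<close> of degree at most \<open>d\<close> without
  constant term is constant along the orbit of this vector under the powers of \<open>g\<close>, but its
  monomials are exponential polynomials with bases different from \<open>1\<close>, so \<open>f\<close> vanishes there.
\<close>

section \<open>Polynomials and polynomial functions\<close>

lemma mpolys_0: "0 \<in> mpolys I"
  by (simp add: mpolys_def)

lemma mpolys_single: "Poly_Mapping.keys t \<subseteq> I \<Longrightarrow> Poly_Mapping.single t c \<in> mpolys I"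
  by (auto simp: mpolys_def)

lemma mpolys_add:
  assumes "p \<in> mpolys I" "q \<in> mpolys I"
  shows "p + q \<in> mpolys I"
  using assms Poly_Mapping.keys_add[of p q] unfolding mpolys_def by blast

lemma mpolys_diff:
  fixes p q :: "('i, 'a::ab_group_add) mpoly"
  assumes "p \<in> mpolys I" "q \<in> mpolys I"
  shows "p - q \<in> mpolys I"
  using assms keys_diff[of p q] unfolding mpolys_def by blast

lemma mpolys_mono: "p \<in> mpolys I \<Longrightarrow> I \<subseteq> J \<Longrightarrow> p \<in> mpolys J"
  by (auto simp: mpolys_def)

lemma mpolys_sum: "(\<And>a. a \<in> A \<Longrightarrow> f a \<in> mpolys I) \<Longrightarrow> (\<Sum>a\<in>A. f a) \<in> mpolys I"
  by (induction A rule: infinite_finite_induct) (auto intro: mpolys_0 mpolys_add)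

lemma mpolys_prod: "(\<And>a. a \<in> A \<Longrightarrow> f a \<in> mpolys I) \<Longrightarrow> (\<Prod>a\<in>A. f a) \<in> mpolys I"
  by (induction A rule: infinite_finite_induct) (auto intro: mpolys_1 mpolys_mult)

lemma mpoly_eval_diff:
  fixes p q :: "('i, 'a::comm_ring_1) mpoly"
  shows "mpoly_eval (p - q) x = mpoly_eval p x - mpoly_eval q x"
  using mpoly_eval_add[of "p - q" q x] by simp

lemma mon_eval_single_1: "mon_eval (Poly_Mapping.single i 1) x = x i"
  by (simp add: mon_eval_def)

lemma mon_eval_at_0: "mon_eval t (\<lambda>_. 0) = (if t = 0 then 1 else 0)"
proof (cases "t = 0")
  case False
  then obtain i where "i \<in> Poly_Mapping.keys t"
    by fastforce
  then show ?thesis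
    using False unfolding mon_eval_def
    by (subst prod_zero) (auto simp: in_keys_iff zero_power intro!: bexI[of _ i])
qed simp

lemma mpoly_eval_at_0: "mpoly_eval p (\<lambda>_. 0) = const_term p"
  unfolding mpoly_eval_def mon_eval_at_0
  by (auto simp: in_keys_iff if_distrib cong: if_cong)

lemma mpoly_eval_prod: "mpoly_eval (\<Prod>a\<in>A. f a) x = (\<Prod>a\<in>A. mpoly_eval (f a) x)"
  by (induction A rule: infinite_finite_induct) (simp_all add: mpoly_eval_mult)

lemma const_term_prod:
  assumes "finite A" "a \<in> A" "const_term (f a) = 0"
  shows "const_term (\<Prod>a\<in>A. f a) = (0 :: 'a::comm_ring_1)"
  unfolding mpoly_eval_at_0[symmetric] mpoly_eval_prod
  using assms by (intro prod_zero) (auto simp: mpoly_eval_at_0)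

lemma mon_eval_cong: "(\<And>i. i \<in> Poly_Mapping.keys t \<Longrightarrow> x i = y i) \<Longrightarrow> mon_eval t x = mon_eval t y"
  by (simp add: mon_eval_def)

lemma mpoly_eval_cong:
  assumes "p \<in> mpolys I" "\<And>i. i \<in> I \<Longrightarrow> x i = y i"
  shows "mpoly_eval p x = mpoly_eval p y"
  unfolding mpoly_eval_def using assms
  by (intro sum.cong refl arg_cong2[of _ _ _ _ "(*)"] mon_eval_cong) (auto simp: mpolys_def)

section \<open>Polynomial functions and their closure properties\<close>

definition polyfun :: "'i set \<Rightarrow> (('i \<Rightarrow> 'a::comm_semiring_1) \<Rightarrow> 'a) \<Rightarrow> bool" where
  "polyfun I F \<longleftrightarrow> (\<exists>p\<in>mpolys I. \<forall>x. mpoly_eval p x = F x)"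

lemma polyfun_const: "polyfun I (\<lambda>_. c)"
  unfolding polyfun_def
  by (rule bexI[of _ "Poly_Mapping.single 0 c"]) (auto intro!: mpolys_single)

lemma polyfun_var: "i \<in> I \<Longrightarrow> polyfun I (\<lambda>x. x i)"
  unfolding polyfun_def
  by (rule bexI[of _ "Poly_Mapping.single (Poly_Mapping.single i 1) 1"])
    (auto intro!: mpolys_single simp: mon_eval_single_1[unfolded One_nat_def])

lemma polyfun_add: "polyfun I F \<Longrightarrow> polyfun I H \<Longrightarrow> polyfun I (\<lambda>x. F x + H x)"
  unfolding polyfun_def
proof (elim bexE)
  fix p q assume "p \<in> mpolys I" "\<forall>x. mpoly_eval p x = F x" "q \<in> mpolys I" "\<forall>x. mpoly_eval q x = H x"
  then show "\<exists>r\<in>mpolys I. \<forall>x. mpoly_eval r x = F x + H x"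
    by (intro bexI[of _ "p + q"]) (simp_all add: mpoly_eval_add mpolys_add)
qed

lemma polyfun_mult: "polyfun I F \<Longrightarrow> polyfun I H \<Longrightarrow> polyfun I (\<lambda>x. F x * H x)"
  unfolding polyfun_def
proof (elim bexE)
  fix p q assume "p \<in> mpolys I" "\<forall>x. mpoly_eval p x = F x" "q \<in> mpolys I" "\<forall>x. mpoly_eval q x = H x"
  then show "\<exists>r\<in>mpolys I. \<forall>x. mpoly_eval r x = F x * H x"
    by (intro bexI[of _ "p * q"]) (simp_all add: mpoly_eval_mult mpolys_mult)
qed

lemma polyfun_sum: "(\<And>a. a \<in> A \<Longrightarrow> polyfun I (F a)) \<Longrightarrow> polyfun I (\<lambda>x. \<Sum>a\<in>A. F a x)"
  by (induction A rule: infinite_finite_induct) (auto intro: polyfun_const polyfun_add)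

lemma polyfun_prod: "(\<And>a. a \<in> A \<Longrightarrow> polyfun I (F a)) \<Longrightarrow> polyfun I (\<lambda>x. \<Prod>a\<in>A. F a x)"
  by (induction A rule: infinite_finite_induct) (auto intro: polyfun_const polyfun_mult)

lemma polyfun_power: "polyfun I F \<Longrightarrow> polyfun I (\<lambda>x. F x ^ k)"
  by (induction k) (auto intro: polyfun_const polyfun_mult)

text \<open>Substitution of polynomial functions for the variables; this is what pulls polynomial
  equations back along maps with polynomial coordinates.\<close>

lemma polyfun_compose:
  assumes "p \<in> mpolys J" "\<And>j. j \<in> J \<Longrightarrow> polyfun I (F j)"
  shows "polyfun I (\<lambda>x. mpoly_eval p (\<lambda>j. F j x))"
  unfolding mpoly_eval_def mon_eval_def
  by (intro polyfun_sum polyfun_mult polyfun_const polyfun_prod polyfun_power assms(2))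
    (use assms(1) in \<open>auto simp: mpolys_def\<close>)

text \<open>By the Leibniz formula. The entries are arbitrary polynomial functions, so that both
  characteristic polynomials and minors are covered.\<close>

lemma polyfun_det:
  fixes f :: "nat \<Rightarrow> nat \<Rightarrow> ('i \<Rightarrow> 'a::comm_ring_1) \<Rightarrow> 'a"
  assumes "\<And>i j. i < n \<Longrightarrow> j < n \<Longrightarrow> polyfun I (f i j)"
  shows "polyfun I (\<lambda>x. det (mat n n (\<lambda>(i, j). f i j x)))"
proof -
  have "det (mat n n (\<lambda>(i, j). f i j x)) =
      (\<Sum>p | p permutes {0..<n}. signof p * (\<Prod>i = 0..<n. f i (p i) x))" for x
    by (subst det_def'[of _ n]) (auto intro!: sum.cong prod.cong simp: permutes_in_image)
  then show ?thesis
    by (auto intro!: polyfun_sum polyfun_mult polyfun_const polyfun_prod assms simp: permutes_in_image)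
qed

section \<open>Noetherianity\<close>

lemma nat_mono_subseq:
  fixes s :: "nat \<Rightarrow> nat"
  shows "\<exists>f :: nat \<Rightarrow> nat. strict_mono f \<and> mono (\<lambda>n. s (f n))"
proof -
  obtain f :: "nat \<Rightarrow> nat" where f: "strict_mono f" "monoseq (\<lambda>n. s (f n))"
    using seq_monosub[of s] by blast
  show ?thesis
  proof (cases "\<forall>m n. m \<le> n \<longrightarrow> s (f m) \<le> s (f n)")
    case True
    then show ?thesis using f(1) by (auto simp: mono_def)
  next
    case False
    then have dec: "\<And>m n. m \<le> n \<Longrightarrow> s (f n) \<le> s (f m)"
      using f(2) by (auto simp: monoseq_def)
    \<comment> \<open>A decreasing sequence of natural numbers is constant from an index
      \<open>N\<close> of a least value on, and a constant sequence is monotone.\<close>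
    obtain N where N: "\<And>n. s (f N) \<le> s (f n)"
      using ex_has_least_nat[of "\<lambda>_. True" _ "\<lambda>n. s (f n)"] by auto
    have "s (f (N + n)) = s (f N)" for n
      using N[of "N + n"] dec[of N "N + n"] by simp
    moreover have "strict_mono (\<lambda>n. f (N + n))"
      using f(1) by (auto simp: strict_mono_def)
    ultimately show ?thesis
      by (intro exI[of _ "\<lambda>n. f (N + n)"]) (auto intro!: monoI)
  qed
qed

text \<open>Induction over the coordinates: a further subsequence, taken for the new coordinate,
  keeps the earlier ones monotone.\<close>

lemma multi_mono_subseq:
  fixes s :: "nat \<Rightarrow> 'i \<Rightarrow> nat"
  assumes "finite I"
  shows "\<exists>f :: nat \<Rightarrow> nat. strict_mono f \<and> (\<forall>i\<in>I. mono (\<lambda>n. s (f n) i))"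
  using assms
proof (induction I)
  case empty
  show ?case by (auto intro: strict_mono_id)
next
  case (insert i I)
  then obtain f :: "nat \<Rightarrow> nat" where f: "strict_mono f" "\<And>j. j \<in> I \<Longrightarrow> mono (\<lambda>n. s (f n) j)" by blast
  obtain h :: "nat \<Rightarrow> nat" where h: "strict_mono h" "mono (\<lambda>n. s (f (h n)) i)"
    using nat_mono_subseq[of "\<lambda>n. s (f n) i"] by blast
  have "mono (\<lambda>n. s (f (h n)) j)" if "j \<in> I" for j
    using f(2)[OF that] strict_mono_mono[OF h(1)] by (simp add: mono_def)
  moreover have "strict_mono (\<lambda>n. f (h n))"
    using f(1) h(1) by (simp add: strict_mono_def)
  ultimately show ?case
    using h(2) by (intro exI[of _ "\<lambda>n. f (h n)"]) auto
qed

text \<open>Along a subsequence that is monotone in every coordinate of \<open>I\<close>, each term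
  divides the next; the first two terms are enough, and their difference is the cofactor
  \<open>u\<close>.\<close>

lemma dickson:
  fixes s :: "nat \<Rightarrow> ('i \<Rightarrow>\<^sub>0 nat)"
  assumes "finite I" "\<And>n. Poly_Mapping.keys (s n) \<subseteq> I"
  shows "\<exists>i j u. i < j \<and> Poly_Mapping.keys u \<subseteq> I \<and> s j = u + s i"
proof -
  obtain f :: "nat \<Rightarrow> nat" where f: "strict_mono f" "\<And>i. i \<in> I \<Longrightarrow> mono (\<lambda>n. Poly_Mapping.lookup (s (f n)) i)"
    using multi_mono_subseq[OF assms(1), of "\<lambda>n. Poly_Mapping.lookup (s n)"] by blast
  let ?u = "s (f 1) - s (f 0)"
  have le: "Poly_Mapping.lookup (s (f 0)) i \<le> Poly_Mapping.lookup (s (f 1)) i" for i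
  proof (cases "i \<in> I")
    case True
    from monoD[OF f(2)[OF this], of 0 1] show ?thesis by simp
  next
    case False
    then have "i \<notin> Poly_Mapping.keys (s (f 0))"
      using assms(2) by blast
    then show ?thesis by (simp add: in_keys_iff)
  qed
  have "s (f 1) = ?u + s (f 0)"
    by (rule poly_mapping_eqI) (use le in \<open>simp add: lookup_add lookup_minus\<close>)
  moreover have "Poly_Mapping.keys ?u \<subseteq> I"
  proof
    fix i assume "i \<in> Poly_Mapping.keys ?u"
    then have "i \<in> Poly_Mapping.keys (s (f 1))"
      by (auto simp: in_keys_iff lookup_minus)
    then show "i \<in> I" using assms(2) by blast
  qed
  moreover have "f 0 < f 1" using f(1) by (simp add: strict_mono_def)
  ultimately show ?thesis by blast
qed

section \<open>Well-foundedness of the lexicographic order on monomials\<close>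

lemma monomial_nonneg: "0 \<le> (u :: 'i::linorder \<Rightarrow>\<^sub>0 nat)"
proof (rule ccontr)
  assume "\<not> 0 \<le> u"
  then have "u < 0" by simp
  then show False
    by (auto simp: less_poly_mapping.rep_eq less_fun_def)
qed

text \<open>By Dickson's lemma an infinite descending chain would contain a term that divides a
  later one. As every monomial is at least \<open>0\<close> and the order respects addition, the
  later term would be at least as large.\<close>

lemma monomial_wf:
  fixes I :: "'i::linorder set"
  assumes "finite I"
  shows "wf {(s, t :: 'i \<Rightarrow>\<^sub>0 nat). s < t \<and> Poly_Mapping.keys s \<subseteq> I \<and> Poly_Mapping.keys t \<subseteq> I}"
  unfolding wf_iff_no_infinite_down_chain
proof clarify
  fix f :: "nat \<Rightarrow> ('i \<Rightarrow>\<^sub>0 nat)"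
  assume *: "\<forall>i. (f (Suc i), f i) \<in> {(s, t). s < t \<and> Poly_Mapping.keys s \<subseteq> I \<and> Poly_Mapping.keys t \<subseteq> I}"
  then obtain i j u where "i < j" and u: "f j = u + f i"
    using dickson[OF assms, of f] by auto
  have "f j < f i"
    using \<open>i < j\<close>
  proof (induction rule: less_Suc_induct)
    case (1 i)
    then show ?case using * by simp
  next
    case (2 i j k)
    then show ?case by simp
  qed
  moreover have "f i \<le> f j"
    unfolding u using add_right_mono[OF monomial_nonneg[of u]] by simp
  ultimately show False by simp
qed

section \<open>Leading monomials of vanishing ideals\<close>

definition vanishing :: "'i set \<Rightarrow> ('i \<Rightarrow> 'a::comm_ring_1) set \<Rightarrow> ('i, 'a) mpoly set" where
  "vanishing I Z = {p \<in> mpolys I. \<forall>x\<in>Z. mpoly_eval p x = 0}"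

text \<open>Over a field these are the monomials of the initial ideal of
  \<open>vanishing I Z\<close> for the lexicographic order.\<close>

definition lead_mons :: "'i::linorder set \<Rightarrow> ('i \<Rightarrow> 'a::comm_ring_1) set \<Rightarrow> ('i \<Rightarrow>\<^sub>0 nat) set" where
  "lead_mons I Z = (\<lambda>p. Max (Poly_Mapping.keys p)) ` (vanishing I Z - {0})"

lemma lead_mons_antimono: "Z \<subseteq> Y \<Longrightarrow> lead_mons I Y \<subseteq> lead_mons I Z"
  by (auto simp: lead_mons_def vanishing_def)

lemma lead_mons_keys: "t \<in> lead_mons I Z \<Longrightarrow> Poly_Mapping.keys t \<subseteq> I"
  using Max_in[OF finite_keys] by (fastforce simp: lead_mons_def vanishing_def mpolys_def)

text \<open>Multiplication by the monomial \<open>u\<close> shifts all monomials of a polynomial and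
  keeps their order, so it shifts the leading one. Closure under multiples is what makes Dickson's
  lemma applicable.\<close>

lemma lead_mons_add:
  assumes "t \<in> lead_mons I Z" "Poly_Mapping.keys u \<subseteq> I"
  shows "u + t \<in> lead_mons I Z"
proof -
  obtain p where p: "p \<in> vanishing I Z" "p \<noteq> 0" "t = Max (Poly_Mapping.keys p)"
    using assms(1) by (auto simp: lead_mons_def)
  let ?q = "Poly_Mapping.single u 1 * p"
  have "?q = (\<Sum>s\<in>Poly_Mapping.keys p. Poly_Mapping.single (u + s) (Poly_Mapping.lookup p s))"
    by (subst (1) mpoly_expand[of p, symmetric]) (simp only: sum_distrib_left mult_single mult_1)
  then have "Poly_Mapping.lookup ?q r =
      (\<Sum>s\<in>Poly_Mapping.keys p. if s + u = r then Poly_Mapping.lookup p s else 0)" for r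
    by (simp add: lookup_sum lookup_single when_def add.commute)
  then have "Poly_Mapping.lookup ?q (u + s) = Poly_Mapping.lookup p s" for s
    by (simp add: add.commute in_keys_iff)
  then have "u + s \<in> Poly_Mapping.keys ?q \<longleftrightarrow> s \<in> Poly_Mapping.keys p" for s
    by (simp add: in_keys_iff)
  moreover have "Poly_Mapping.keys ?q \<subseteq> (+) u ` Poly_Mapping.keys p"
    using keys_mult[of "Poly_Mapping.single u 1" p] by (auto split: if_splits)
  ultimately have keys: "Poly_Mapping.keys ?q = (+) u ` Poly_Mapping.keys p"
    by blast
  have ne: "Poly_Mapping.keys p \<noteq> {}"
    using p(2) by simp
  have "Max (Poly_Mapping.keys ?q) = u + t"
    unfolding keys p(3)
  proof (rule Max_eqI)
    show "u + Max (Poly_Mapping.keys p) \<in> (+) u ` Poly_Mapping.keys p"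
      using Max_in[OF finite_keys ne] by (rule imageI)
  qed (use Max_ge[OF finite_keys] in \<open>force intro: add_left_mono\<close>)+
  moreover have "?q \<in> vanishing I Z"
    using p(1) assms(2) by (auto simp: vanishing_def mpoly_eval_mult intro!: mpolys_mult mpolys_single)
  moreover have "?q \<noteq> 0"
    using keys ne by auto
  ultimately show ?thesis
    unfolding lead_mons_def by (intro image_eqI[of _ _ ?q]) auto
qed

text \<open>
  The division step of Hilbert's basis theorem: a polynomial in the difference of the two vanishing
  ideals with smallest leading monomial cannot be reduced modulo the smaller ideal.
\<close>

lemma lead_mons_strict:
  fixes Z Y :: "('i::linorder \<Rightarrow> 'a::field) set"
  assumes I: "finite I" and "Z \<subseteq> Y" "vanishing I Z \<noteq> vanishing I Y"
  shows "lead_mons I Z - lead_mons I Y \<noteq> {}"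
proof
  assume *: "lead_mons I Z - lead_mons I Y = {}"
  let ?D = "vanishing I Z - vanishing I Y" and ?m = "\<lambda>p :: ('i, 'a) mpoly. Max (Poly_Mapping.keys p)"
  let ?R = "{(s, t :: 'i \<Rightarrow>\<^sub>0 nat). s < t \<and> Poly_Mapping.keys s \<subseteq> I \<and> Poly_Mapping.keys t \<subseteq> I}"
  have "vanishing I Y \<subseteq> vanishing I Z"
    using \<open>Z \<subseteq> Y\<close> by (auto simp: vanishing_def)
  then obtain p0 where "p0 \<in> ?D" using assms(3) by blast
  obtain p where p: "p \<in> ?D" and pmin: "\<And>q. (?m q, ?m p) \<in> ?R \<Longrightarrow> q \<notin> ?D"
    using wfE_min[OF wf_inv_image[OF monomial_wf[OF I], of ?m] \<open>p0 \<in> ?D\<close>] by auto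
  have p0: "p \<noteq> 0" using p by (auto simp: vanishing_def mpolys_0)
  then have "?m p \<in> lead_mons I Z" using p by (auto simp: lead_mons_def)
  then obtain q where q: "q \<in> vanishing I Y" "q \<noteq> 0" "?m p = ?m q"
    using * by (auto simp: lead_mons_def)
  define M where "M = ?m p"
  have Mq: "M \<in> Poly_Mapping.keys q" and Mp: "M \<in> Poly_Mapping.keys p"
    using q p0 Max_in[OF finite_keys, of q] Max_in[OF finite_keys, of p] by (auto simp: M_def)
  have le: "\<And>t. t \<in> Poly_Mapping.keys p \<Longrightarrow> t \<le> M" "\<And>t. t \<in> Poly_Mapping.keys q \<Longrightarrow> t \<le> M"
    by (simp add: M_def) (simp add: M_def q(3))
  \<comment> \<open>Both leading monomials equal \<open>M\<close>, so subtracting \<open>c\<close>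
    times \<open>q\<close> from \<open>p\<close> cancels it. Since \<open>q\<close> lies in the
    smaller ideal, the remainder \<open>r\<close> stays in the difference \<open>?D\<close>, with a
    smaller leading monomial.\<close>
  define c where "c = Poly_Mapping.lookup p M / Poly_Mapping.lookup q M"
  define r where "r = p - Poly_Mapping.single 0 c * q"
  have lr: "Poly_Mapping.lookup (Poly_Mapping.single 0 c * q) t = c * Poly_Mapping.lookup q t" for t
    by (simp add: mult_map_scale_conv_mult[symmetric] map.rep_eq when_def)
  have cq: "Poly_Mapping.single 0 c * q \<in> vanishing I Y"
    using q(1) by (auto simp: vanishing_def mpoly_eval_mult intro!: mpolys_mult mpolys_single)
  have rZ: "r \<in> vanishing I Z"
    using p cq \<open>vanishing I Y \<subseteq> vanishing I Z\<close>
    by (auto simp: r_def vanishing_def mpoly_eval_diff intro!: mpolys_diff)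
  have rY: "r \<notin> vanishing I Y"
  proof
    assume "r \<in> vanishing I Y"
    then have "r + Poly_Mapping.single 0 c * q \<in> vanishing I Y"
      using cq by (auto simp: vanishing_def mpoly_eval_add intro!: mpolys_add)
    then show False using p by (simp add: r_def)
  qed
  have r0: "r \<noteq> 0" using rY by (auto simp: vanishing_def mpolys_0)
  have "?m r \<in> Poly_Mapping.keys r"
    using r0 Max_in[OF finite_keys] by simp
  moreover have "Poly_Mapping.lookup r M = 0"
    using Mq unfolding r_def lookup_minus lr by (simp add: c_def in_keys_iff)
  moreover have "t \<le> M" if "t \<in> Poly_Mapping.keys r" for t
  proof -
    have "t \<in> Poly_Mapping.keys p \<or> t \<in> Poly_Mapping.keys q"
      using that by (auto simp: r_def lookup_minus lr in_keys_iff)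
    then show ?thesis using le by blast
  qed
  ultimately have "?m r < ?m p"
    unfolding M_def[symmetric] by (auto simp: in_keys_iff order.order_iff_strict)
  moreover have "Poly_Mapping.keys (?m r) \<subseteq> I" "Poly_Mapping.keys (?m p) \<subseteq> I"
    using \<open>?m r \<in> Poly_Mapping.keys r\<close> rZ Mp p by (auto simp: vanishing_def mpolys_def M_def)
  ultimately have "r \<notin> ?D" using pmin by simp
  then show False using rZ rY by simp
qed

text \<open>If the ideals grew at every step, each step would contribute a leading monomial
  \<open>t k\<close> that was absent before. By Dickson's lemma some \<open>t j\<close> is a
  multiple of an earlier \<open>t i\<close>, so it was already present.\<close>

lemma vanishing_dcc:
  fixes Z :: "nat \<Rightarrow> ('i::linorder \<Rightarrow> 'a::field) set"
  assumes I: "finite I" and sub: "\<And>k. Z (Suc k) \<subseteq> Z k"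
  shows "\<exists>k. vanishing I (Z (Suc k)) = vanishing I (Z k)"
proof (rule ccontr)
  assume "\<not> ?thesis"
  then have "\<exists>t. t \<in> lead_mons I (Z (Suc k)) \<and> t \<notin> lead_mons I (Z k)" for k
    using lead_mons_strict[OF I sub[of k]] by auto
  then have "\<forall>k. \<exists>t. t \<in> lead_mons I (Z (Suc k)) \<and> t \<notin> lead_mons I (Z k)"
    by blast
  from choice[OF this] obtain t where
    t: "\<And>k. t k \<in> lead_mons I (Z (Suc k))" "\<And>k. t k \<notin> lead_mons I (Z k)"
    by blast
  obtain i j u where iju: "i < j" "Poly_Mapping.keys u \<subseteq> I" "t j = u + t i"
    using dickson[of I t, OF I lead_mons_keys[OF t(1)]] by blast
  \<comment> \<open>The monomial \<open>t i\<close> is present from stage \<open>Suc i\<close> on,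
    so \<open>i < j\<close> is just enough to have it at stage \<open>j\<close>.\<close>
  have "Z j \<subseteq> Z (Suc i)"
    by (rule lift_Suc_antimono_le[of Z, OF sub]) (use iju(1) in simp)
  then have "t i \<in> lead_mons I (Z j)"
    using t(1) lead_mons_antimono by blast
  then have "t j \<in> lead_mons I (Z j)"
    unfolding iju(3) by (rule lead_mons_add[OF _ iju(2)])
  then show False
    using t(2) by blast
qed

section \<open>Exponential polynomials\<close>

text \<open>The action of a polynomial on sequences in which the variable acts as the shift.\<close>

definition act :: "'a::comm_ring_1 poly \<Rightarrow> (nat \<Rightarrow> 'a) \<Rightarrow> nat \<Rightarrow> 'a" where
  "act p h m = (\<Sum>k\<le>degree p. coeff p k * h (m + k))"

lemma act_superset: "degree p \<le> N \<Longrightarrow> act p h m = (\<Sum>k\<le>N. coeff p k * h (m + k))"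
  unfolding act_def by (rule sum.mono_neutral_left) (auto simp: coeff_eq_0)

lemma act_0 [simp]: "act 0 h m = 0"
  by (simp add: act_def)

lemma act_pCons: "act (pCons a p) h m = a * h m + act p h (Suc m)"
proof -
  have "act (pCons a p) h m = (\<Sum>k\<le>Suc (degree p). coeff (pCons a p) k * h (m + k))"
    by (rule act_superset) (rule degree_pCons_le)
  also have "\<dots> = a * h m + act p h (Suc m)"
    by (subst sum.atMost_Suc_shift) (simp add: act_def)
  finally show ?thesis .
qed

lemma act_1 [simp]: "act 1 h m = h m"
  by (simp add: act_def)

lemma act_add: "act (p + q) h m = act p h m + act q h m"
proof -
  let ?N = "max (degree p) (degree q)"
  have "act (p + q) h m = (\<Sum>k\<le>?N. coeff (p + q) k * h (m + k))"
    by (rule act_superset) (rule degree_add_le_max)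
  then show ?thesis
    by (simp add: act_superset[of p ?N] act_superset[of q ?N] distrib_right sum.distrib)
qed

lemma act_smult: "act (smult c p) h m = c * act p h m"
  by (subst act_superset[of _ "degree p"])
    (simp_all add: act_def sum_distrib_left mult.assoc degree_smult_le)

text \<open>Sequences form a module over the polynomial ring, so a product acts as a
  composition.\<close>

lemma act_mult: "act (p * q) h m = act p (act q h) m"
  by (induction p arbitrary: m) (simp_all add: act_pCons act_add act_smult)

lemma act_poly_sum: "act (\<Sum>i\<in>S. p i) h m = (\<Sum>i\<in>S. act (p i) h m)"
  by (induction S rule: infinite_finite_induct) (simp_all add: act_add)

lemma act_fun_add: "act p (\<lambda>m. h m + k m) m = act p h m + act p k m"
  by (simp add: act_def distrib_left sum.distrib)

lemma act_fun_zero [simp]: "act p (\<lambda>m. 0) m = 0"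
  by (simp add: act_def)

lemma act_fun_cmult: "act p (\<lambda>m. c * h m) m = c * act p h m"
  by (simp add: act_def sum_distrib_left mult.left_commute)

lemma act_fun_sum: "act p (\<lambda>m. \<Sum>i\<in>S. h i m) m = (\<Sum>i\<in>S. act p (h i) m)"
  by (induction S rule: infinite_finite_induct) (simp_all add: act_fun_add)

text \<open>A geometric sequence is an eigenvector of the shift, on which a polynomial acts through
  its value at the ratio.\<close>

lemma act_geometric: "act p (\<lambda>m. c * \<mu> ^ m) m = poly p \<mu> * (c * \<mu> ^ m)"
  by (simp add: act_def poly_altdef sum_distrib_left power_add mult_ac)

lemma act_linear: "act [:- \<mu>, 1:] h m = h (Suc m) - \<mu> * h m"
  by (simp add: act_pCons)

lemma act_shift: "act p (\<lambda>m. h (Suc m)) m = act p h (Suc m)"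
  by (simp add: act_def)

text \<open>Generalized eigenvectors of the shift with eigenvalue \<open>\<mu>\<close>. Annihilation
  by a power of the shift minus \<open>\<mu>\<close> is required instead of the form "polynomial in
  \<open>m\<close> times \<open>\<mu> ^ m\<close>", which is too narrow in positive
  characteristic.\<close>

definition expo :: "'a::comm_ring_1 \<Rightarrow> (nat \<Rightarrow> 'a) \<Rightarrow> bool" where
  "expo \<mu> h \<longleftrightarrow> (\<exists>K. \<forall>m. act ([:- \<mu>, 1:] ^ K) h m = 0)"

lemma act_power_mono:
  assumes "\<forall>m. act (p ^ K) h m = 0" "K \<le> L"
  shows "act (p ^ L) h m = 0"
proof -
  have "act (p ^ K) h = (\<lambda>m. 0)" using assms(1) by auto
  moreover have "p ^ L = p ^ (L - K) * p ^ K"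
    using assms(2) by (simp add: power_add[symmetric])
  ultimately show ?thesis by (simp add: act_mult)
qed

lemma expo_add:
  assumes "expo \<mu> h" "expo \<mu> k"
  shows "expo \<mu> (\<lambda>m. h m + k m)"
proof -
  obtain K L where K: "\<forall>m. act ([:- \<mu>, 1:] ^ K) h m = 0" and L: "\<forall>m. act ([:- \<mu>, 1:] ^ L) k m = 0"
    using assms unfolding expo_def by blast
  have "act ([:- \<mu>, 1:] ^ max K L) (\<lambda>m. h m + k m) m = 0" for m
    by (simp add: act_fun_add act_power_mono[OF K] act_power_mono[OF L])
  then show ?thesis unfolding expo_def by blast
qed

lemma expo_zero: "expo \<mu> (\<lambda>m. 0)"
  by (simp add: expo_def)

lemma expo_cmult: "expo \<mu> h \<Longrightarrow> expo \<mu> (\<lambda>m. c * h m)"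
  unfolding expo_def act_fun_cmult by (metis mult_zero_right)

lemma expo_geometric: "expo \<mu> (\<lambda>m. c * \<mu> ^ m)"
  unfolding expo_def act_geometric by (rule exI[of _ 1]) simp

text \<open>A twisted Leibniz rule: the shift minus \<open>\<mu> * \<nu>\<close> sends the product
  of \<open>h\<close> and \<open>k\<close> to (shift minus \<open>\<mu>\<close>) of \<open>h\<close>
  times the shifted \<open>k\<close>, plus \<open>\<mu>\<close> times \<open>h\<close> times (shift
  minus \<open>\<nu>\<close>) of \<open>k\<close>. Both summands have a smaller sum of exponents
  \<open>K + L\<close>, which drives the induction.\<close>

lemma expo_mult:
  assumes "expo \<mu> h" "expo \<nu> k"
  shows "expo (\<mu> * \<nu>) (\<lambda>m. h m * k m)"
proof -
  have "expo (\<mu> * \<nu>) (\<lambda>m. h m * k m)"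
    if "\<forall>m. act ([:- \<mu>, 1:] ^ K) h m = 0" "\<forall>m. act ([:- \<nu>, 1:] ^ L) k m = 0" "N = K + L" for K L N
    using that
  proof (induction N arbitrary: K L h k rule: less_induct)
    case (less N)
    show ?case
    proof (cases "K = 0 \<or> L = 0")
      case True
      then have "h = (\<lambda>m. 0) \<or> k = (\<lambda>m. 0)" using less.prems by auto
      then show ?thesis by (auto intro: expo_zero)
    next
      case False
      then obtain K' L' where KL: "K = Suc K'" "L = Suc L'"
        by (metis not0_implies_Suc)
      let ?h = "act [:- \<mu>, 1:] h" and ?k = "act [:- \<nu>, 1:] k" and ?P = "[:- (\<mu> * \<nu>), 1:]"
      have h': "\<forall>m. act ([:- \<mu>, 1:] ^ K') ?h m = 0"
        using less.prems(1) by (simp add: KL act_mult[symmetric] mult.commute del: mult_pCons_left mult_pCons_right)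
      have k': "\<forall>m. act ([:- \<nu>, 1:] ^ L') ?k m = 0"
        using less.prems(2) by (simp add: KL act_mult[symmetric] mult.commute del: mult_pCons_left mult_pCons_right)
      have sk: "\<forall>m. act ([:- \<nu>, 1:] ^ L) (\<lambda>m. k (Suc m)) m = 0"
        using less.prems(2) by (simp add: act_shift)
      have "expo (\<mu> * \<nu>) (\<lambda>m. ?h m * k (Suc m))"
        by (rule less.IH[OF _ h' sk refl]) (simp add: less.prems(3) KL)
      moreover have "expo (\<mu> * \<nu>) (\<lambda>m. h m * ?k m)"
        by (rule less.IH[OF _ less.prems(1) k' refl]) (simp add: less.prems(3) KL)
      ultimately have "expo (\<mu> * \<nu>) (\<lambda>m. ?h m * k (Suc m) + \<mu> * (h m * ?k m))"
        by (intro expo_add expo_cmult)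
      also have "(\<lambda>m. ?h m * k (Suc m) + \<mu> * (h m * ?k m)) = act ?P (\<lambda>m. h m * k m)"
        by (rule ext) (simp add: act_linear algebra_simps)
      finally obtain J where "\<forall>m. act (?P ^ J) (act ?P (\<lambda>m. h m * k m)) m = 0"
        unfolding expo_def by blast
      then have "\<forall>m. act (?P ^ Suc J) (\<lambda>m. h m * k m) m = 0"
        by (simp only: power_Suc2 act_mult simp_thms)
      then show ?thesis unfolding expo_def by blast
    qed
  qed
  then show ?thesis using assms unfolding expo_def by blast
qed

lemma expo_power:
  assumes "expo \<mu> h"
  shows "expo (\<mu> ^ k) (\<lambda>m. h m ^ k)"
proof (induction k)
  case 0
  then show ?case using expo_geometric[of 1 1] by simp
next
  case (Suc k)
  then show ?case using expo_mult[OF assms Suc.IH] by simp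
qed

lemma expo_prod:
  "finite I \<Longrightarrow> (\<And>i. i \<in> I \<Longrightarrow> expo (\<mu> i) (h i)) \<Longrightarrow> expo (\<Prod>i\<in>I. \<mu> i) (\<lambda>m. \<Prod>i\<in>I. h i m)"
proof (induction I rule: finite_induct)
  case empty
  show ?case using expo_geometric[of 1 1] by simp
next
  case (insert i I)
  then show ?case using expo_mult[of "\<mu> i" "h i" "\<Prod>i\<in>I. \<mu> i" "\<lambda>m. \<Prod>i\<in>I. h i m"] by simp
qed

text \<open>The product of the annihilators of the summands kills the whole sum and has a nonzero
  value at \<open>1\<close>; on a constant sequence a polynomial acts by exactly that value.\<close>

lemma constant_sum_expo_eq_0:
  fixes H :: "'s \<Rightarrow> nat \<Rightarrow> 'a::field"
  assumes S: "finite S" and H: "\<And>s. s \<in> S \<Longrightarrow> \<exists>\<mu>. \<mu> \<noteq> 1 \<and> expo \<mu> (H s)"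
    and c: "\<And>m. (\<Sum>s\<in>S. H s m) = c"
  shows "c = 0"
proof -
  have "\<exists>p. poly p 1 \<noteq> 0 \<and> (\<forall>m. act p (\<lambda>m. \<Sum>s\<in>S. H s m) m = 0)"
    using S H
  proof (induction S)
    case empty
    show ?case by (rule exI[of _ 1]) simp
  next
    case (insert s S)
    then obtain p where p: "poly p 1 \<noteq> 0" "\<forall>m. act p (\<lambda>m. \<Sum>s\<in>S. H s m) m = 0" by blast
    obtain \<mu> K where \<mu>: "\<mu> \<noteq> 1" "\<forall>m. act ([:- \<mu>, 1:] ^ K) (H s) m = 0"
      using insert.prems unfolding expo_def by blast
    let ?q = "[:- \<mu>, 1:] ^ K"
    have z: "act p (\<lambda>m. \<Sum>s\<in>S. H s m) = (\<lambda>m. 0)" "act ?q (H s) = (\<lambda>m. 0)"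
      using p(2) \<mu>(2) by auto
    have "act (p * ?q) (H s) m = 0" "act (?q * p) (\<lambda>m. \<Sum>s\<in>S. H s m) m = 0" for m
      unfolding act_mult z by simp_all
    then have "\<forall>m. act (p * ?q) (\<lambda>m. \<Sum>s\<in>insert s S. H s m) m = 0"
      using insert.hyps by (simp add: act_fun_add mult.commute)
    moreover have "poly (p * ?q) 1 \<noteq> 0"
      using p(1) \<mu>(1) by simp
    ultimately show ?case by blast
  qed
  then obtain p where "poly p 1 \<noteq> 0" "act p (\<lambda>m. c) 0 = 0"
    unfolding c by blast
  then show ?thesis
    using act_geometric[of p c 1 0] by simp
qed

section \<open>Cayley--Hamilton\<close>

text \<open>The recurrence says that \<open>char_poly_matrix A\<close>, with its entries acting
  through the shift, kills the tuple \<open>h\<close>. Multiplication from the left by the adjugate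
  turns this matrix into the characteristic polynomial times the identity.\<close>

lemma act_char_poly:
  fixes A :: "'a::field mat"
  assumes A: "A \<in> carrier_mat n n" and l: "l < n"
    and h: "\<And>i m. i < n \<Longrightarrow> h i (Suc m) = (\<Sum>j<n. A $$ (i, j) * h j m)"
  shows "act (char_poly A) (h l) m = 0"
proof -
  define C where "C = char_poly_matrix A"
  have C: "C \<in> carrier_mat n n" using A by (simp add: C_def)
  have D: "adj_mat C \<in> carrier_mat n n" "adj_mat C * C = char_poly A \<cdot>\<^sub>m 1\<^sub>m n"
    using adj_mat[OF C] by (simp_all add: C_def char_poly_def)
  have row: "(\<Sum>j<n. act (C $$ (i, j)) (h j) m) = 0" if "i < n" for i m
  proof -
    have "act (C $$ (i, j)) (h j) m = (if i = j then h j (Suc m) else 0) - A $$ (i, j) * h j m"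
      if "j < n" for j
      using A \<open>i < n\<close> that by (auto simp: C_def char_poly_matrix_def act_pCons)
    then show ?thesis
      using that by (simp add: sum_subtractf h)
  qed
  have entry: "(if l = j then char_poly A else 0) = (\<Sum>i<n. adj_mat C $$ (l, i) * C $$ (i, j))"
    if "j < n" for j
  proof -
    have "(adj_mat C * C) $$ (l, j) = (\<Sum>i<n. adj_mat C $$ (l, i) * C $$ (i, j))"
      using D(1) C l that by (simp add: scalar_prod_def atLeast0LessThan)
    then show ?thesis unfolding D(2) using l that by (simp split: if_splits)
  qed
  have "act (char_poly A) (h l) m = (\<Sum>j<n. act (if l = j then char_poly A else 0) (h j) m)"
    using l by (subst sum.remove[of _ l]) auto
  also have "\<dots> = (\<Sum>j<n. \<Sum>i<n. act (adj_mat C $$ (l, i)) (act (C $$ (i, j)) (h j)) m)"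
    by (intro sum.cong refl) (simp add: entry act_poly_sum act_mult)
  also have "\<dots> = (\<Sum>i<n. act (adj_mat C $$ (l, i)) (\<lambda>m. \<Sum>j<n. act (C $$ (i, j)) (h j) m) m)"
    unfolding act_fun_sum by (rule sum.swap)
  also have "\<dots> = 0"
    by (simp add: row)
  finally show ?thesis .
qed

section \<open>Orbits of a vector under the powers of a matrix\<close>

lemma pow_mat_Suc_left:
  assumes "A \<in> carrier_mat n n"
  shows "A ^\<^sub>m Suc k = A * A ^\<^sub>m k"
proof (induction k)
  case (Suc k)
  have "A ^\<^sub>m Suc (Suc k) = (A * A ^\<^sub>m k) * A"
    using Suc by simp
  then show ?case
    using assms by (simp add: assoc_mult_mat[of _ n n _ n _ n])
qed (use assms in simp)

lemma pow_mat_add_mult: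
  assumes "A \<in> carrier_mat n n"
  shows "A ^\<^sub>m (k + l) = A ^\<^sub>m k * A ^\<^sub>m l"
proof (induction l)
  case (Suc l)
  then show ?case
    using assms by (simp add: assoc_mult_mat[of _ n n _ n _ n])
qed (use assms in simp)

lemma mult_mat_vec_sum:
  "A \<in> carrier_mat n n \<Longrightarrow> v \<in> carrier_vec n \<Longrightarrow> i < n \<Longrightarrow> (A *\<^sub>v v) $ i = (\<Sum>j<n. A $$ (i, j) * v $ j)"
  by (simp add: scalar_prod_def atLeast0LessThan)

lemma cayley_hamilton_vec:
  fixes A :: "'a::field mat"
  assumes A: "A \<in> carrier_mat n n" and e: "e \<in> carrier_vec n" and i: "i < n"
  shows "act (char_poly A) (\<lambda>m. (A ^\<^sub>m m *\<^sub>v e) $ i) m = 0"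
proof (rule act_char_poly[OF A i, of "\<lambda>i m. (A ^\<^sub>m m *\<^sub>v e) $ i"])
  fix i m assume "i < n"
  have "A ^\<^sub>m Suc m *\<^sub>v e = A *\<^sub>v (A ^\<^sub>m m *\<^sub>v e)"
    unfolding pow_mat_Suc_left[OF A] using A e by (simp add: assoc_mult_mat_vec[of _ n n _ n])
  then show "(A ^\<^sub>m Suc m *\<^sub>v e) $ i = (\<Sum>j<n. A $$ (i, j) * (A ^\<^sub>m m *\<^sub>v e) $ j)"
    using mult_mat_vec_sum[OF A mult_mat_vec_carrier[OF pow_carrier_mat[OF A] e] \<open>i < n\<close>] by simp
qed

text \<open>Along the orbit of a vector the shift acts as \<open>A\<close>, so the shift minus
  \<open>1\<close> acts as \<open>A\<close> minus the identity.\<close>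

lemma act_linear_power_vec:
  fixes A :: "'a::field mat"
  assumes A: "A \<in> carrier_mat n n" and e: "e \<in> carrier_vec n" and i: "i < n"
  shows "act ([:- 1, 1:] ^ k) (\<lambda>m. (A ^\<^sub>m m *\<^sub>v e) $ i) m = (A ^\<^sub>m m *\<^sub>v ((A - 1\<^sub>m n) ^\<^sub>m k *\<^sub>v e)) $ i"
  using e
proof (induction k arbitrary: e)
  case 0
  then show ?case using A by simp
next
  case (Suc k)
  let ?N = "A - 1\<^sub>m n"
  have N: "?N \<in> carrier_mat n n" by (rule minus_carrier_mat) simp
  have "act [:- 1, 1:] (\<lambda>m. (A ^\<^sub>m m *\<^sub>v e) $ i) = (\<lambda>m. (A ^\<^sub>m m *\<^sub>v (?N *\<^sub>v e)) $ i)"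
  proof
    fix m
    have "?N *\<^sub>v e = A *\<^sub>v e - e"
      using A Suc.prems by (simp add: minus_mult_distrib_mat_vec[of _ n n])
    moreover have "A ^\<^sub>m Suc m *\<^sub>v e = A ^\<^sub>m m *\<^sub>v (A *\<^sub>v e)"
      using A Suc.prems by (simp add: assoc_mult_mat_vec[of _ n n _ n])
    ultimately show "act [:- 1, 1:] (\<lambda>m. (A ^\<^sub>m m *\<^sub>v e) $ i) m = (A ^\<^sub>m m *\<^sub>v (?N *\<^sub>v e)) $ i"
      using A Suc.prems i unfolding act_linear
      by (simp add: mult_minus_distrib_mat_vec[of _ n n] del: pow_mat.simps)
  qed
  then have "act ([:- 1, 1:] ^ Suc k) (\<lambda>m. (A ^\<^sub>m m *\<^sub>v e) $ i) m =
      act ([:- 1, 1:] ^ k) (\<lambda>m. (A ^\<^sub>m m *\<^sub>v (?N *\<^sub>v e)) $ i) m"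
    by (simp only: power_Suc2 act_mult)
  also have "\<dots> = (A ^\<^sub>m m *\<^sub>v (?N ^\<^sub>m k *\<^sub>v (?N *\<^sub>v e))) $ i"
    by (rule Suc.IH) (use N Suc.prems in simp)
  also have "?N ^\<^sub>m k *\<^sub>v (?N *\<^sub>v e) = ?N ^\<^sub>m Suc k *\<^sub>v e"
    using N Suc.prems by (simp add: assoc_mult_mat_vec[of _ n n _ n])
  finally show ?case .
qed

text \<open>At \<open>m = 0\<close> the \<open>n\<close>-th power of the shift minus
  \<open>1\<close> gives the columns of the \<open>n\<close>-th power of \<open>A\<close> minus the
  identity; by Cayley-Hamilton it gives zero.\<close>

lemma unipotentI_char_poly:
  fixes A :: "'a::field mat"
  assumes A: "A \<in> carrier_mat n n" and char: "char_poly A = [:- 1, 1:] ^ n"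
  shows "unipotent n A"
  unfolding unipotent_def
proof (intro exI[of _ n] eq_matI)
  let ?N = "(A - 1\<^sub>m n) ^\<^sub>m n"
  have N: "?N \<in> carrier_mat n n" by (intro pow_carrier_mat minus_carrier_mat) simp
  then show "dim_row ?N = dim_row (0\<^sub>m n n)" "dim_col ?N = dim_col (0\<^sub>m n n)" by simp_all
  fix i j assume "i < dim_row (0\<^sub>m n n :: 'a mat)" "j < dim_col (0\<^sub>m n n :: 'a mat)"
  then have ij: "i < n" "j < n" by simp_all
  have "(?N *\<^sub>v unit_vec n j) $ i = 0"
    using act_linear_power_vec[OF A _ ij(1), of "unit_vec n j" n 0]
      cayley_hamilton_vec[OF A _ ij(1), of "unit_vec n j" 0] A N by (simp add: char)
  moreover have "(?N *\<^sub>v unit_vec n j) $ i = ?N $$ (i, j)"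
    using N ij by simp
  ultimately show "?N $$ (i, j) = 0\<^sub>m n n $$ (i, j)" using ij by simp
qed

text \<open>An eigenvector of the transpose may well be orthogonal to \<open>w\<close>, hence the
  generalized eigenspace. The factor \<open>q\<close> of the characteristic polynomial that does not
  vanish at \<open>\<nu>\<close> maps into it and changes the pairing with \<open>w\<close> only by
  the nonzero scalar \<open>poly q \<nu>\<close>.\<close>

lemma left_generalized_eigenvector:
  fixes A :: "'a::field mat"
  assumes A: "A \<in> carrier_mat n n" and w: "w \<in> carrier_vec n" "w \<noteq> 0\<^sub>v n" "A *\<^sub>v w = \<nu> \<cdot>\<^sub>v w"
  shows "\<exists>l\<in>carrier_vec n. w \<bullet> l \<noteq> 0 \<and> (\<forall>j<n. expo \<nu> (\<lambda>m. (transpose_mat A ^\<^sub>m m *\<^sub>v l) $ j))"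
proof -
  let ?B = "transpose_mat A"
  have B: "?B \<in> carrier_mat n n" using A by simp
  obtain i where i: "i < n" "w $ i \<noteq> 0"
    using w(1,2) by (metis carrier_vecD eq_vecI index_zero_vec)
  define e where "e = (unit_vec n i :: 'a vec)"
  have e: "e \<in> carrier_vec n" by (simp add: e_def)
  have we: "w \<bullet> e \<noteq> 0" using w(1) i by (simp add: e_def)
  define r where "r j m = (?B ^\<^sub>m m *\<^sub>v e) $ j" for j m
  have nz: "char_poly ?B \<noteq> 0" using degree_monic_char_poly[OF B] by auto
  obtain q where q: "char_poly ?B = [:- \<nu>, 1:] ^ Polynomial.order \<nu> (char_poly ?B) * q" "\<not> [:- \<nu>, 1:] dvd q"
    using order_decomp[OF nz] by blast
  define K where "K = Polynomial.order \<nu> (char_poly ?B)"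
  \<comment> \<open>This is \<open>q\<close>, evaluated at the transpose and applied to
    \<open>e\<close>, expressed through the orbit sequences \<open>r j\<close>.\<close>
  define l where "l = vec n (\<lambda>j. act q (r j) 0)"
  have l: "l \<in> carrier_vec n" by (simp add: l_def)
  \<comment> \<open>Pairing with \<open>w\<close> is an eigenfunctional of \<open>?B\<close> for
    \<open>\<nu>\<close>, because \<open>w\<close> is an eigenvector of \<open>A\<close>.\<close>
  have wr: "w \<bullet> (?B ^\<^sub>m m *\<^sub>v x) = (w \<bullet> x) * \<nu> ^ m" if "x \<in> carrier_vec n" for m x
    using that
  proof (induction m arbitrary: x)
    case 0
    then show ?case using B by simp
  next
    case (Suc m)
    have "w \<bullet> (?B ^\<^sub>m Suc m *\<^sub>v x) = w \<bullet> (?B ^\<^sub>m m *\<^sub>v (?B *\<^sub>v x))"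
      using B Suc.prems by (simp add: assoc_mult_mat_vec[of _ n n _ n])
    also have "\<dots> = (w \<bullet> (?B *\<^sub>v x)) * \<nu> ^ m"
      using B Suc.prems by (intro Suc.IH) simp
    also have "w \<bullet> (?B *\<^sub>v x) = (?B *\<^sub>v x) \<bullet> w"
      using B w Suc.prems by (intro comm_scalar_prod[of _ n]) auto
    also have "\<dots> = x \<bullet> (A *\<^sub>v w)"
      using transpose_vec_mult_scalar[OF A w(1) Suc.prems] .
    also have "\<dots> = \<nu> * (w \<bullet> x)"
      using w Suc.prems by (simp add: comm_scalar_prod[of x n])
    finally show ?case by simp
  qed
  have "w \<bullet> l = (\<Sum>i<n. w $ i * act q (r i) 0)"
    by (simp add: l_def scalar_prod_def atLeast0LessThan)
  also have "\<dots> = act q (\<lambda>m. \<Sum>i<n. w $ i * r i m) 0"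
    by (simp add: act_fun_sum act_fun_cmult)
  also have "(\<lambda>m. \<Sum>i<n. w $ i * r i m) = (\<lambda>m. w \<bullet> (?B ^\<^sub>m m *\<^sub>v e))"
    using A by (simp add: r_def scalar_prod_def[of w] atLeast0LessThan del: index_mult_mat_vec)
  also have "act q (\<lambda>m. w \<bullet> (?B ^\<^sub>m m *\<^sub>v e)) 0 = poly q \<nu> * (w \<bullet> e)"
    unfolding wr[OF e] act_geometric by simp
  finally have "w \<bullet> l \<noteq> 0"
    using we q(2) by (simp add: poly_eq_0_iff_dvd)
  moreover have "expo \<nu> (\<lambda>m. (?B ^\<^sub>m m *\<^sub>v l) $ j)" if j: "j < n" for j
  proof -
    have "(?B ^\<^sub>m m *\<^sub>v l) $ j = act q (r j) m" for m
    proof -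
      have Bm: "?B ^\<^sub>m m \<in> carrier_mat n n" using B by simp
      have "(?B ^\<^sub>m m *\<^sub>v l) $ j = (\<Sum>i<n. (?B ^\<^sub>m m) $$ (j, i) * act q (r i) 0)"
        unfolding mult_mat_vec_sum[OF Bm l j] by (simp add: l_def)
      also have "\<dots> = act q (\<lambda>k. \<Sum>i<n. (?B ^\<^sub>m m) $$ (j, i) * r i k) 0"
        by (simp add: act_fun_sum act_fun_cmult)
      also have "(\<lambda>k. \<Sum>i<n. (?B ^\<^sub>m m) $$ (j, i) * r i k) = (\<lambda>k. r j (m + k))"
      proof
        fix k
        have Bk: "?B ^\<^sub>m k *\<^sub>v e \<in> carrier_vec n"
          using pow_carrier_mat[OF B] e by (rule mult_mat_vec_carrier)
        have "?B ^\<^sub>m (m + k) *\<^sub>v e = ?B ^\<^sub>m m *\<^sub>v (?B ^\<^sub>m k *\<^sub>v e)"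
          unfolding pow_mat_add_mult[OF B] using B e by (simp add: assoc_mult_mat_vec[of _ n n _ n])
        then show "(\<Sum>i<n. (?B ^\<^sub>m m) $$ (j, i) * r i k) = r j (m + k)"
          using mult_mat_vec_sum[OF Bm Bk j] by (simp add: r_def)
      qed
      also have "act q (\<lambda>k. r j (m + k)) 0 = act q (r j) m"
        by (simp add: act_def)
      finally show ?thesis .
    qed
    then have "act ([:- \<nu>, 1:] ^ K) (\<lambda>m. (?B ^\<^sub>m m *\<^sub>v l) $ j) m = act (char_poly ?B) (r j) m" for m
      unfolding q(1)[folded K_def] act_mult by (simp add: K_def)
    then show ?thesis
      using cayley_hamilton_vec[OF B e j] unfolding expo_def r_def by auto
  qed
  ultimately show ?thesis using l by blast
qed

section \<open>The Zariski topology\<close>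

lemma mult_GL: "x \<otimes>\<^bsub>GL n\<^esub> y = x * y"
  by (simp add: GL_def units_of_mult ring_mat_simps)

lemma one_GL: "\<one>\<^bsub>GL n\<^esub> = 1\<^sub>m n"
  by (simp add: GL_def units_of_one ring_mat_simps)

lemma GL_carrier_mat: "A \<in> carrier (GL n) \<Longrightarrow> A \<in> carrier_mat n n"
  by (simp add: carrier_GL)

lemma one_in_GL: "1\<^sub>m n \<in> carrier (GL n)"
  by (simp add: carrier_GL)

lemma mult_in_GL: "A \<in> carrier (GL n) \<Longrightarrow> B \<in> carrier (GL n) \<Longrightarrow> A * B \<in> carrier (GL n)"
  by (auto simp: carrier_GL det_mult)

lemma closedin_zariski_subset: "closedin (zariski_GL n) X \<Longrightarrow> X \<subseteq> carrier (GL n)"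
  using closedin_subset topspace_zariski by blast

text \<open>The entries of \<open>g * A * h\<close> are linear in those of \<open>A\<close>, so
  polynomial equations pull back to polynomial equations. Two-sided translations include
  conjugations.\<close>

lemma continuous_map_translation:
  fixes g h :: "'a::field mat"
  assumes g: "g \<in> carrier (GL n)" and h: "h \<in> carrier (GL n)"
  shows "continuous_map (zariski_GL n) (zariski_GL n) (\<lambda>A. g * A * h)"
  unfolding continuous_map_closedin topspace_zariski
proof (intro conjI ballI allI impI)
  show "(\<lambda>A. g * A * h) \<in> carrier (GL n) \<rightarrow> carrier (GL n)"
    using g h by (auto intro!: mult_in_GL)
  fix X :: "'a mat set" assume "closedin (zariski_GL n) X"
  then obtain F where F: "F \<subseteq> matrix_polys n" "X = {A \<in> carrier (GL n). \<forall>p\<in>F. eval_mat p A = 0}"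
    unfolding closedin_zariski by blast
  let ?I = "{..<n} \<times> {..<n}"
  define E where "E x = (\<lambda>(i, j). \<Sum>k<n. g $$ (i, k) * (\<Sum>l<n. x (k, l) * h $$ (l, j)))"
    for x :: "nat \<times> nat \<Rightarrow> 'a"
  have "polyfun ?I (\<lambda>x. E x ij)" for ij
    unfolding E_def by (cases ij) (auto intro!: polyfun_sum polyfun_mult polyfun_const polyfun_var)
  then have "polyfun ?I (\<lambda>x. mpoly_eval p (E x))" if "p \<in> F" for p
    using F(1) that polyfun_compose[of p ?I ?I "\<lambda>ij x. E x ij"] by blast
  then have "\<forall>p\<in>F. \<exists>q. q \<in> matrix_polys n \<and> (\<forall>x. mpoly_eval q x = mpoly_eval p (E x))"
    unfolding polyfun_def by blast
  from bchoice[OF this] obtain q where q: "\<And>p. p \<in> F \<Longrightarrow> q p \<in> matrix_polys n"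
    "\<And>p x. p \<in> F \<Longrightarrow> mpoly_eval (q p) x = mpoly_eval p (E x)"
    by blast
  have "eval_mat (q p) A = eval_mat p (g * A * h)" if "p \<in> F" "A \<in> carrier (GL n)" for p A
    unfolding q(2)[OF that(1)]
  proof (rule mpoly_eval_cong)
    show "p \<in> mpolys ?I" using F(1) that(1) by auto
    show "E (($$) A) i = (g * A * h) $$ i" if "i \<in> ?I" for i
      using that GL_carrier_mat[OF g] GL_carrier_mat[OF h] GL_carrier_mat[OF \<open>A \<in> _\<close>]
      by (auto simp: E_def scalar_prod_def atLeast0LessThan intro!: sum.cong)
  qed
  then have "{A \<in> carrier (GL n). g * A * h \<in> X} = {A \<in> carrier (GL n). \<forall>p\<in>q ` F. eval_mat p A = 0}"
    using F(2) g h by (auto intro: mult_in_GL)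
  moreover have "q ` F \<subseteq> matrix_polys n"
    using q(1) by auto
  ultimately show "closedin (zariski_GL n) {A \<in> carrier (GL n). g * A * h \<in> X}"
    unfolding closedin_zariski by blast
qed

lemma connectedin_translation:
  assumes "g \<in> carrier (GL n)" "h \<in> carrier (GL n)" "connectedin (zariski_GL n) S"
  shows "connectedin (zariski_GL n) ((\<lambda>A. g * A * h) ` S)"
  using connectedin_continuous_map_image[OF continuous_map_translation[OF assms(1,2)] assms(3)] .

text \<open>For fixed \<open>t\<close> the value is the determinant of \<open>t\<close> minus
  \<open>A\<close>, a polynomial in the entries of \<open>A\<close>. These fibres are the closed
  sets to which connectedness is applied later.\<close>

lemma char_poly_fibre_closed:
  fixes t c :: "'a::field"
  shows "closedin (zariski_GL n) {A \<in> carrier (GL n). poly (char_poly A) t = c}"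
proof -
  let ?I = "{..<n} \<times> {..<n}"
  let ?D = "\<lambda>x :: nat \<times> nat \<Rightarrow> 'a.
    det (mat n n (\<lambda>(i, j). (if i = j then t else 0) + (- 1) * x (i, j))) + (- c)"
  have "polyfun ?I ?D"
    by (intro polyfun_add polyfun_const polyfun_det polyfun_mult polyfun_var) auto
  then obtain p where p: "p \<in> mpolys ?I" "\<And>x. mpoly_eval p x = ?D x"
    unfolding polyfun_def by blast
  have "poly (char_poly A) t = c \<longleftrightarrow> eval_mat p A = 0" if "A \<in> carrier (GL n)" for A
  proof -
    have A: "A \<in> carrier_mat n n" using that by (rule GL_carrier_mat)
    have "- char_matrix A t = mat n n (\<lambda>(i, j). (if i = j then t else 0) + (- 1) * A $$ (i, j))"
      using A by (intro eq_matI) (auto simp: char_matrix_def)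
    then show ?thesis
      unfolding p(2) char_poly_matrix[OF A] by simp
  qed
  then have "{A \<in> carrier (GL n). poly (char_poly A) t = c} =
      {A \<in> carrier (GL n). \<forall>q\<in>{p}. eval_mat q A = 0}"
    by auto
  then show ?thesis
    unfolding closedin_zariski using p(1) by blast
qed

section \<open>Descending chains of closed sets\<close>

lemma zariski_dcc:
  fixes Z :: "nat \<Rightarrow> 'a::field mat set"
  assumes cl: "\<And>k. closedin (zariski_GL n) (Z k)" and sub: "\<And>k. Z (Suc k) \<subset> Z k"
  shows False
proof -
  let ?I = "{..<n} \<times> {..<n}" and ?e = "\<lambda>A :: 'a mat. ($$) A"
  have "?e ` Z (Suc k) \<subseteq> ?e ` Z k" for k
    using sub[of k] by (intro image_mono) simp
  then have "\<exists>k. vanishing ?I (?e ` Z (Suc k)) = vanishing ?I (?e ` Z k)"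
    by (intro vanishing_dcc[of ?I "\<lambda>k. ?e ` Z k"]) auto
  then obtain k where k: "vanishing ?I (?e ` Z (Suc k)) = vanishing ?I (?e ` Z k)" ..
  obtain F where F: "F \<subseteq> mpolys ?I" "Z (Suc k) = {A \<in> carrier (GL n). \<forall>p\<in>F. eval_mat p A = 0}"
    using cl[of "Suc k"] unfolding closedin_zariski by blast
  \<comment> \<open>The equations of the smaller set vanish on it and, the two ideals being equal,
    also on the larger set; so the sets coincide.\<close>
  have "F \<subseteq> vanishing ?I (?e ` Z (Suc k))"
    using F by (auto simp: vanishing_def)
  then have "F \<subseteq> vanishing ?I (?e ` Z k)" unfolding k .
  then have "Z k \<subseteq> Z (Suc k)"
    using F(2) closedin_zariski_subset[OF cl[of k]] by (auto simp: vanishing_def)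
  then show False using sub[of k] by blast
qed

text \<open>Otherwise every infinite closed subset of \<open>G\<close> would properly contain
  another one, and dependent choice would give an infinite descending chain.\<close>

lemma minimal_infinite_closed:
  assumes "closedin (zariski_GL n) G" "infinite G"
  shows "\<exists>Z\<subseteq>G. closedin (zariski_GL n) Z \<and> infinite Z \<and>
    (\<forall>Y. closedin (zariski_GL n) Y \<and> Y \<subset> Z \<longrightarrow> finite Y)"
proof (rule ccontr)
  assume *: "\<not> ?thesis"
  define P where "P Z \<longleftrightarrow> Z \<subseteq> G \<and> closedin (zariski_GL n) Z \<and> infinite Z" for Z
  have step: "\<exists>Y. P Y \<and> Y \<subset> Z" if "P Z" for Z
  proof (rule ccontr)
    assume "\<nexists>Y. P Y \<and> Y \<subset> Z"
    then have "\<forall>Y. closedin (zariski_GL n) Y \<and> Y \<subset> Z \<longrightarrow> finite Y"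
      using that unfolding P_def by (meson order_trans psubset_imp_subset)
    then have "\<exists>Z\<subseteq>G. closedin (zariski_GL n) Z \<and> infinite Z \<and>
        (\<forall>Y. closedin (zariski_GL n) Y \<and> Y \<subset> Z \<longrightarrow> finite Y)"
      using that unfolding P_def by (intro exI[of _ Z]) simp
    then show False
      using * by simp
  qed
  have "P G" using assms by (simp add: P_def)
  have "\<exists>Z. \<forall>k. P (Z k) \<and> Z (Suc k) \<subset> Z k"
    by (rule dependent_nat_choice[of "\<lambda>_. P" "\<lambda>_ Z Y. Y \<subset> Z"]) (rule exI[of _ G], rule \<open>P G\<close>, rule step)
  then obtain Z where Z: "\<forall>k. P (Z k) \<and> Z (Suc k) \<subset> Z k" ..
  show False
  proof (rule zariski_dcc[of n Z])
    show "closedin (zariski_GL n) (Z k)" for k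
      using Z[rule_format, of k] by (simp add: P_def)
    show "Z (Suc k) \<subset> Z k" for k
      using Z[rule_format, of k] by blast
  qed
qed

text \<open>A separation would cut \<open>Z\<close> into two proper closed parts, both finite by
  minimality. Together with the chain condition this provides an infinite connected subset.\<close>

lemma minimal_infinite_connected:
  assumes cl: "closedin (zariski_GL n) Z" and inf: "infinite Z"
    and minimal: "\<And>Y. closedin (zariski_GL n) Y \<Longrightarrow> Y \<subset> Z \<Longrightarrow> finite Y"
  shows "connectedin (zariski_GL n) Z"
  unfolding connectedin_closedin topspace_zariski
proof (intro conjI notI)
  show "Z \<subseteq> carrier (GL n)" using cl by (rule closedin_zariski_subset)
  assume "\<exists>E1 E2. closedin (zariski_GL n) E1 \<and> closedin (zariski_GL n) E2 \<and>
      Z \<subseteq> E1 \<union> E2 \<and> E1 \<inter> E2 \<inter> Z = {} \<and> E1 \<inter> Z \<noteq> {} \<and> E2 \<inter> Z \<noteq> {}"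
  then obtain E1 E2 where E: "closedin (zariski_GL n) E1" "closedin (zariski_GL n) E2"
      "Z \<subseteq> E1 \<union> E2" "E1 \<inter> E2 \<inter> Z = {}" "E1 \<inter> Z \<noteq> {}" "E2 \<inter> Z \<noteq> {}"
    by blast
  have "finite (E1 \<inter> Z)" "finite (E2 \<inter> Z)"
    using E by (auto intro!: minimal closedin_Int cl)
  then have "finite ((E1 \<inter> Z) \<union> (E2 \<inter> Z))" by blast
  moreover have "Z = (E1 \<inter> Z) \<union> (E2 \<inter> Z)" using E(3) by blast
  ultimately show False using inf by simp
qed

section \<open>Eigenvalues of large order\<close>

definition identity_component :: "nat \<Rightarrow> 'a::field mat set \<Rightarrow> 'a mat set" where
  "identity_component n G = connected_component_of_set (subtopology (zariski_GL n) G) (1\<^sub>m n)"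

context
  fixes n :: nat and G :: "'a::field mat set"
  assumes G: "linear_algebraic_group n G"
begin

lemma subgroup_GL: "subgroup G (GL n)"
  using G by (simp add: linear_algebraic_group_def)

lemma subset_GL: "G \<subseteq> carrier (GL n)"
  using subgroup.subset[OF subgroup_GL] .

lemma closedin_group: "closedin (zariski_GL n) G"
  using G by (simp add: linear_algebraic_group_def)

lemma one_in_group: "1\<^sub>m n \<in> G"
  using subgroup.one_closed[OF subgroup_GL] by (simp add: one_GL)

lemma mult_in_group: "g \<in> G \<Longrightarrow> h \<in> G \<Longrightarrow> g * h \<in> G"
  using subgroup.m_closed[OF subgroup_GL] by (simp add: mult_GL)

lemma inv_in_group: "g \<in> G \<Longrightarrow> inv\<^bsub>GL n\<^esub> g \<in> G"
  by (rule subgroup.m_inv_closed[OF subgroup_GL])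

lemma group_inv:
  assumes "g \<in> G"
  shows "g * inv\<^bsub>GL n\<^esub> g = 1\<^sub>m n" "inv\<^bsub>GL n\<^esub> g * g = 1\<^sub>m n"
  using group.r_inv[OF group_GL, of g n] group.l_inv[OF group_GL, of g n] subsetD[OF subset_GL assms]
  by (simp_all add: mult_GL one_GL)

lemma identity_component_subset: "identity_component n G \<subseteq> G"
  unfolding identity_component_def
  using connected_component_of_subset_topspace[of "subtopology (zariski_GL n) G" "1\<^sub>m n"] by auto

lemma one_in_identity_component: "1\<^sub>m n \<in> identity_component n G"
  using one_in_group subset_GL
  by (auto simp: identity_component_def connected_component_of_refl topspace_zariski)

lemma connectedin_identity_component: "connectedin (zariski_GL n) (identity_component n G)"
  unfolding identity_component_def
  using connectedin_connected_component_of[of "subtopology (zariski_GL n) G" "1\<^sub>m n"]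
  by (simp add: connectedin_subtopology)

lemma closedin_identity_component: "closedin (zariski_GL n) (identity_component n G)"
  unfolding identity_component_def
  by (rule closedin_trans_full[OF closedin_connected_component_of closedin_group])

lemma identity_component_maximal:
  assumes "connectedin (zariski_GL n) S" "1\<^sub>m n \<in> S" "S \<subseteq> G"
  shows "S \<subseteq> identity_component n G"
  unfolding identity_component_def
  by (rule connected_component_of_maximal) (use assms in \<open>auto simp: connectedin_subtopology\<close>)

text \<open>Translations are continuous, so the translate of \<open>S\<close> is connected, and it
  contains the identity. With \<open>h\<close> trivial this handles quotients, with \<open>h\<close>
  the inverse of \<open>g\<close> conjugates.\<close>

lemma translation_in_identity_component:
  assumes g: "g \<in> G" and h: "h \<in> G" and S: "connectedin (zariski_GL n) S" "S \<subseteq> G"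
    and one: "x \<in> S" "g * x * h = 1\<^sub>m n" and y: "y \<in> S"
  shows "g * y * h \<in> identity_component n G"
proof -
  let ?T = "(\<lambda>A. g * A * h) ` S"
  have "connectedin (zariski_GL n) ?T"
    by (rule connectedin_translation) (use g h S(1) subset_GL in auto)
  moreover have "1\<^sub>m n \<in> ?T"
    using one by (intro image_eqI[of _ _ x]) simp_all
  moreover have "?T \<subseteq> G"
    using g h S(2) by (auto intro!: mult_in_group)
  ultimately have "?T \<subseteq> identity_component n G"
    by (rule identity_component_maximal)
  then show ?thesis using y by blast
qed

text \<open>Translation by the inverse of \<open>x\<close> moves \<open>x\<close> to the identity.
  With the component itself for \<open>S\<close> this gives the subgroup property; with an infinite
  connected set it shows that the component is infinite.\<close>

lemma left_quotient_in_identity_component: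
  assumes S: "connectedin (zariski_GL n) S" "S \<subseteq> G" and x: "x \<in> S" and y: "y \<in> S"
  shows "inv\<^bsub>GL n\<^esub> x * y \<in> identity_component n G"
proof -
  have xG: "x \<in> G" using x S(2) by blast
  have yG: "y \<in> G" using y S(2) by blast
  have carr: "inv\<^bsub>GL n\<^esub> x * x \<in> carrier_mat n n" "inv\<^bsub>GL n\<^esub> x * y \<in> carrier_mat n n"
    using inv_in_group[OF xG] xG yG subset_GL mult_in_group GL_carrier_mat by blast+
  have "inv\<^bsub>GL n\<^esub> x * y * 1\<^sub>m n \<in> identity_component n G"
    by (rule translation_in_identity_component[OF inv_in_group[OF xG] one_in_group S x _ y])
      (use carr(1) group_inv(2)[OF xG] in simp)
  then show ?thesis by (simp only: right_mult_one_mat[OF carr(2)])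
qed

lemma subgroup_identity_component: "subgroup (identity_component n G) ((GL n)\<lparr>carrier := G\<rparr>)"
proof (rule group.subgroupI)
  show grp: "group ((GL n)\<lparr>carrier := G\<rparr>)"
    by (rule subgroup.subgroup_is_group[OF subgroup_GL group_GL])
  show "identity_component n G \<subseteq> carrier ((GL n)\<lparr>carrier := G\<rparr>)"
    using identity_component_subset by simp
  show "identity_component n G \<noteq> {}"
    using one_in_identity_component by blast
  \<comment> \<open>Closure under left quotients yields inverses, with the identity as right factor,
    and then products, with an inverse for \<open>a\<close>.\<close>
  have quot: "inv\<^bsub>GL n\<^esub> a * b \<in> identity_component n G"
    if "a \<in> identity_component n G" "b \<in> identity_component n G" for a b
    using left_quotient_in_identity_component[OF connectedin_identity_component identity_component_subset] that .
  have inv_eq: "inv\<^bsub>(GL n)\<lparr>carrier := G\<rparr>\<^esub> a = inv\<^bsub>GL n\<^esub> a" if "a \<in> G" for a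
    using group.m_inv_consistent[OF group_GL subgroup_GL that] .
  have inv: "inv\<^bsub>GL n\<^esub> a \<in> identity_component n G" if "a \<in> identity_component n G" for a
  proof -
    have "inv\<^bsub>GL n\<^esub> a \<in> carrier_mat n n"
      using that identity_component_subset inv_in_group subset_GL GL_carrier_mat by blast
    then show ?thesis using quot[OF that one_in_identity_component] by simp
  qed
  show "inv\<^bsub>(GL n)\<lparr>carrier := G\<rparr>\<^esub> a \<in> identity_component n G" if "a \<in> identity_component n G" for a
    using inv[OF that] inv_eq[of a] that identity_component_subset by auto
  show "a \<otimes>\<^bsub>(GL n)\<lparr>carrier := G\<rparr>\<^esub> b \<in> identity_component n G"
    if "a \<in> identity_component n G" "b \<in> identity_component n G" for a b
  proof -
    have "inv\<^bsub>GL n\<^esub> (inv\<^bsub>GL n\<^esub> a) = a"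
      using that(1) identity_component_subset subset_GL by (intro group.inv_inv[OF group_GL]) blast
    then show ?thesis using quot[OF inv[OF that(1)] that(2)] by (simp add: mult_GL)
  qed
qed

lemma normal_identity_component: "identity_component n G \<lhd> (GL n)\<lparr>carrier := G\<rparr>"
proof -
  have grp: "group ((GL n)\<lparr>carrier := G\<rparr>)"
    by (rule subgroup.subgroup_is_group[OF subgroup_GL group_GL])
  show ?thesis
    unfolding group.normal_inv_iff[OF grp]
  proof (intro conjI ballI subgroup_identity_component)
    fix x h assume "x \<in> carrier ((GL n)\<lparr>carrier := G\<rparr>)" and h: "h \<in> identity_component n G"
    then have x: "x \<in> G" by simp
    have "x * h * inv\<^bsub>GL n\<^esub> x \<in> identity_component n G"
    proof (rule translation_in_identity_component[OF x inv_in_group[OF x]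
          connectedin_identity_component identity_component_subset one_in_identity_component _ h])
      show "x * 1\<^sub>m n * inv\<^bsub>GL n\<^esub> x = 1\<^sub>m n"
        using group_inv(1)[OF x] GL_carrier_mat[of x n] x subset_GL by auto
    qed
    then show "x \<otimes>\<^bsub>(GL n)\<lparr>carrier := G\<rparr>\<^esub> h \<otimes>\<^bsub>(GL n)\<lparr>carrier := G\<rparr>\<^esub> inv\<^bsub>(GL n)\<lparr>carrier := G\<rparr>\<^esub> x
        \<in> identity_component n G"
      using group.m_inv_consistent[OF group_GL subgroup_GL x] by (simp add: mult_GL)
  qed
qed

text \<open>A minimal infinite closed subset of \<open>G\<close> is connected, and its translate by
  the inverse of one of its points lies in the component.\<close>

lemma infinite_identity_component:
  assumes "infinite G"
  shows "infinite (identity_component n G)"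
proof -
  obtain Z where Z: "Z \<subseteq> G" "closedin (zariski_GL n) Z" "infinite Z"
    "\<forall>Y. closedin (zariski_GL n) Y \<and> Y \<subset> Z \<longrightarrow> finite Y"
    using minimal_infinite_closed[OF closedin_group assms] by (elim exE conjE)
  have con: "connectedin (zariski_GL n) Z"
    by (rule minimal_infinite_connected[OF Z(2,3)]) (simp add: Z(4))
  obtain z where z: "z \<in> Z" using Z(3) by fastforce
  have sub: "(\<lambda>y. inv\<^bsub>GL n\<^esub> z * y) ` Z \<subseteq> identity_component n G"
    by (rule image_subsetI) (rule left_quotient_in_identity_component[OF con Z(1) z])
  have "inj_on (\<lambda>y. inv\<^bsub>GL n\<^esub> z * y) Z"
  proof (rule inj_onI)
    fix a b assume ab: "a \<in> Z" "b \<in> Z" "inv\<^bsub>GL n\<^esub> z * a = inv\<^bsub>GL n\<^esub> z * b"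
    have "a \<in> carrier (GL n)" "b \<in> carrier (GL n)" "inv\<^bsub>GL n\<^esub> z \<in> carrier (GL n)"
      using ab z Z(1) subset_GL inv_in_group by blast+
    moreover from this(3) have "inv\<^bsub>GL n\<^esub> z \<in> Units (GL n)"
      by (simp add: group.Units_eq[OF group_GL])
    ultimately show "a = b"
      using ab(3) monoid.Units_l_cancel[OF group.is_monoid[OF group_GL], of "inv\<^bsub>GL n\<^esub> z" n a b]
      by (simp add: mult_GL)
  qed
  then show ?thesis
    using sub Z(3) finite_imageD finite_subset by blast
qed

end

section \<open>Eigenvalues over an algebraically closed field\<close>

lemma char_poly_split:
  fixes A :: "'a::alg_closed_field mat"
  assumes A: "A \<in> carrier_mat n n"
  shows "\<exists>M. size M = n \<and> char_poly A = (\<Prod>x\<in>#M. [:- x, 1:])"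
proof -
  have "degree (char_poly A) = n" "lead_coeff (char_poly A) = 1"
    using degree_monic_char_poly[OF A] by auto
  moreover from this have "char_poly A \<noteq> 0" by auto
  ultimately show ?thesis
    using alg_closed_imp_factorization[of "char_poly A"] by auto
qed

text \<open>Over a finite field the product of all linear factors \<open>[:- a, 1:]\<close>,
  increased by one, is a nonconstant polynomial without roots.\<close>

lemma infinite_alg_closed: "infinite (UNIV :: 'a::alg_closed_field set)"
proof
  assume fin: "finite (UNIV :: 'a set)"
  let ?p = "(\<Prod>a\<in>UNIV. [:- a, 1:]) + 1 :: 'a poly"
  have "poly ?p x = 1" for x
    using fin by (auto simp: poly_prod intro: prod_zero)
  moreover have "degree ?p > 0"
  proof -
    have "degree (\<Prod>a\<in>(UNIV::'a set). [:- a, 1:]) = card (UNIV :: 'a set)"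
      by (subst degree_prod_eq_sum_degree) auto
    then show ?thesis
      using fin by (subst degree_add_eq_left) (auto simp: card_gt_0_iff)
  qed
  ultimately show False
    using alg_closed_imp_poly_has_root[of ?p] by auto
qed

text \<open>For infinite \<open>G\<close>, the finite number of possible values makes the
  characteristic polynomial constant on the connected set \<open>?C\<close>. Hence \<open>?C\<close>
  consists of unipotent elements and is trivial by reductivity, although it is infinite.\<close>

lemma finite_if_eigenvalues_bounded_order:
  fixes G :: "'a::alg_closed_field mat set"
  assumes red: "reductive_group n G" and M: "M > 0"
    and ev: "\<And>g t. g \<in> G \<Longrightarrow> poly (char_poly g) t = 0 \<Longrightarrow> t ^ M = 1"
  shows "finite G"
proof (rule ccontr)
  assume inf: "infinite G"
  have G: "linear_algebraic_group n G" using red by (simp add: reductive_group_def)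
  let ?C = "identity_component n G"
  define R where "R = {t :: 'a. t ^ M = 1}"
  have finR: "finite R"
  proof -
    have "R \<subseteq> {t. poly (monom 1 M - 1) t = 0}"
      by (auto simp: R_def poly_monom)
    moreover have "monom 1 M - 1 \<noteq> (0 :: 'a poly)"
      using M by (metis degree_1 degree_monom_eq eq_iff_diff_eq_0 less_numeral_extra(3) zero_neq_one)
    ultimately show ?thesis
      using poly_roots_finite finite_subset by blast
  qed
  \<comment> \<open>The possible values at \<open>t\<close>: products of \<open>t - x\<close> over
    \<open>n\<close> roots of unity \<open>x\<close>. Multisets of roots are listed as lists of
    length \<open>n\<close>, of which there are finitely many.\<close>
  define V where "V t = (\<lambda>xs. \<Prod>x\<in>#mset xs. t - x) ` {xs. set xs \<subseteq> R \<and> length xs = n}" for t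
  have finV: "finite (V t)" for t
    unfolding V_def by (intro finite_imageI finite_lists_length_eq finR)
  have val: "poly (char_poly g) t \<in> V t" if "g \<in> G" for g t
  proof -
    have "g \<in> carrier_mat n n"
      using that subset_GL[OF G] GL_carrier_mat by blast
    from char_poly_split[OF this] obtain N where N: "size N = n" "char_poly g = (\<Prod>x\<in>#N. [:- x, 1:])"
      by blast
    obtain xs where xs: "mset xs = N" using ex_mset by blast
    have eval: "poly (char_poly g) s = (\<Prod>x\<in>#N. s - x)" for s
      unfolding N(2) by (simp add: poly_prod_mset)
    have "x \<in> R" if "x \<in># N" for x
    proof -
      have "poly (char_poly g) x = 0"
        unfolding eval using that by (auto simp: prod_mset_zero_iff)
      then show ?thesis using ev[OF \<open>g \<in> G\<close>] by (simp add: R_def)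
    qed
    then show ?thesis
      unfolding V_def eval using N(1) xs by (intro image_eqI[of _ _ xs]) auto
  qed
  have const: "poly (char_poly g) t = poly (char_poly (1\<^sub>m n)) t" if g: "g \<in> ?C" for g t
  proof (rule ccontr)
    define c where "c = poly (char_poly (1\<^sub>m n :: 'a mat)) t"
    assume "poly (char_poly g) t \<noteq> poly (char_poly (1\<^sub>m n)) t"
    then have ne: "poly (char_poly g) t \<noteq> c" by (simp add: c_def)
    define F where "F c = {A \<in> carrier (GL n). poly (char_poly A) t = c}" for c
    \<comment> \<open>The fibre over the value at the identity and the finite union of the other
      fibres are closed and would separate \<open>?C\<close>.\<close>
    let ?E1 = "F c" and ?E2 = "\<Union>(F ` (V t - {c}))"
    have cl: "closedin (zariski_GL n) ?E1" "closedin (zariski_GL n) ?E2"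
      using finV by (auto simp: F_def intro!: char_poly_fibre_closed closedin_Union)
    have sub: "?C \<subseteq> G" by (rule identity_component_subset[OF G])
    have "?C \<subseteq> ?E1 \<union> ?E2"
      using sub subset_GL[OF G] val[of _ t] by (fastforce simp: F_def)
    moreover have "?E1 \<inter> ?E2 \<inter> ?C = {}" by (auto simp: F_def)
    moreover have "1\<^sub>m n \<in> ?E1 \<inter> ?C"
      using one_in_identity_component[OF G] by (auto simp: F_def c_def one_in_GL)
    moreover have "g \<in> ?E2 \<inter> ?C"
      using g ne val[of g t] sub subset_GL[OF G] by (auto simp: F_def)
    ultimately show False
      using connectedin_identity_component[OF G] cl unfolding connectedin_closedin by blast
  qed
  have one: "char_poly (1\<^sub>m n :: 'a mat) = [:- 1, 1:] ^ n"
  proof -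
    have "map (\<lambda>a. [:- a, 1:]) (diag_mat (1\<^sub>m n :: 'a mat)) = replicate n [:- 1, 1:]"
      by (rule nth_equalityI) (auto simp: diag_mat_def)
    moreover have "upper_triangular (1\<^sub>m n :: 'a mat)" by auto
    ultimately show ?thesis
      by (simp add: char_poly_upper_triangular[of _ n] prod_list_replicate)
  qed
  have "unipotent n g" if g: "g \<in> ?C" for g
  proof (rule unipotentI_char_poly)
    show "g \<in> carrier_mat n n"
      using g identity_component_subset[OF G] subset_GL[OF G] GL_carrier_mat by blast
    \<comment> \<open>Equal values at all points of an infinite field force equal
      polynomials.\<close>
    have "poly (char_poly g - char_poly (1\<^sub>m n)) t = 0" for t
      using const[OF g] by simp
    then have "char_poly g - char_poly (1\<^sub>m n) = 0"
      using poly_roots_finite[of "char_poly g - char_poly (1\<^sub>m n)"] infinite_alg_closed by auto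
    then show "char_poly g = [:- 1, 1:] ^ n" by (simp add: one)
  qed
  then have "?C \<subseteq> unipotent_radical n G"
    unfolding unipotent_radical_def
    using normal_identity_component[OF G] closedin_identity_component[OF G]
      connectedin_identity_component[OF G] by blast
  then have "finite ?C"
    using red finite_subset unfolding reductive_group_def by (metis finite.emptyI finite_insert)
  then show False using infinite_identity_component[OF G inf] by simp
qed

text \<open>Every positive \<open>k\<close> up to \<open>N\<close> divides \<open>fact N\<close>, so
  this one exponent excludes all of them at once.\<close>

lemma eigenvalue_large_order:
  fixes G :: "'a::alg_closed_field mat set"
  assumes red: "reductive_group n G" and "infinite G"
  shows "\<exists>g\<in>G. \<exists>t. poly (char_poly g) t = 0 \<and> (\<forall>k. 0 < k \<and> k \<le> N \<longrightarrow> t ^ k \<noteq> 1)"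
proof -
  have "\<not> (\<forall>g\<in>G. \<forall>t. poly (char_poly g) t = 0 \<longrightarrow> t ^ fact N = 1)"
    using finite_if_eigenvalues_bounded_order[OF red, of "fact N"] assms(2) by auto
  then obtain g t where g: "g \<in> G" "poly (char_poly g) t = 0" "t ^ fact N \<noteq> 1" by blast
  have "t ^ k \<noteq> 1" if "0 < k" "k \<le> N" for k
  proof
    assume "t ^ k = 1"
    moreover have "k dvd fact N"
      using that by (intro dvd_fact) auto
    then obtain l where "fact N = k * l" by (rule dvdE)
    ultimately show False using g(3) by (simp add: power_mult)
  qed
  then show ?thesis using g by blast
qed

section \<open>Kronecker powers\<close>

text \<open>A pair of indices is numbered in mixed radix, and quotient and remainder recover its two
  members.\<close>

definition kron :: "'a::comm_ring_1 mat \<Rightarrow> 'a mat \<Rightarrow> 'a mat" where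
  "kron A B = mat (dim_row A * dim_row B) (dim_col A * dim_col B)
     (\<lambda>(i, j). A $$ (i div dim_row B, j div dim_col B) * B $$ (i mod dim_row B, j mod dim_col B))"

lemma kron_carrier:
  "A \<in> carrier_mat a b \<Longrightarrow> B \<in> carrier_mat c d \<Longrightarrow> kron A B \<in> carrier_mat (a * c) (b * d)"
  by (auto simp: kron_def)

lemma sum_div_mod:
  fixes f :: "nat \<Rightarrow> nat \<Rightarrow> 'a::comm_monoid_add"
  shows "(\<Sum>k<b * q. f (k div q) (k mod q)) = (\<Sum>x<b. \<Sum>y<q. f x y)"
proof -
  have "(\<Sum>k<b * q. f (k div q) (k mod q)) = (\<Sum>x<b. \<Sum>k\<in>{x * q..<x * q + q}. f (k div q) (k mod q))"
    by (rule sum.nat_group[symmetric])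
  also have "\<dots> = (\<Sum>x<b. \<Sum>y<q. f x y)"
  proof (rule sum.cong[OF refl])
    fix x
    have "(\<Sum>k\<in>{x * q..<x * q + q}. f (k div q) (k mod q)) =
        (\<Sum>y\<in>{0..<q}. f ((y + x * q) div q) ((y + x * q) mod q))"
      using sum.shift_bounds_nat_ivl[of "\<lambda>k. f (k div q) (k mod q)" 0 "x * q" q]
      by (simp add: add.commute)
    also have "\<dots> = (\<Sum>y<q. f x y)"
      by (auto simp: atLeast0LessThan intro!: sum.cong)
    finally show "(\<Sum>k\<in>{x * q..<x * q + q}. f (k div q) (k mod q)) = (\<Sum>y<q. f x y)" .
  qed
  finally show ?thesis .
qed

lemma div_mod_less: "i < a * (b :: nat) \<Longrightarrow> i div b < a \<and> i mod b < b"
  by (cases "b = 0") (auto simp: less_mult_imp_div_less)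

text \<open>The mixed product rule, that is, functoriality of the tensor product: the sum over the
  inner index splits into a double sum over its two digits.\<close>

lemma kron_mult:
  assumes A: "A \<in> carrier_mat a b" and C: "C \<in> carrier_mat b c"
    and B: "B \<in> carrier_mat p q" and D: "D \<in> carrier_mat q r"
  shows "kron A B * kron C D = kron (A * C) (B * D)"
proof (rule eq_matI)
  fix i j assume "i < dim_row (kron (A * C) (B * D))" "j < dim_col (kron (A * C) (B * D))"
  then have ij: "i < a * p" "j < c * r"
    using A B C D by (auto simp: kron_def)
  note dm = div_mod_less[OF ij(1)] div_mod_less[OF ij(2)]
  let ?f = "\<lambda>x y. (A $$ (i div p, x) * B $$ (i mod p, y)) * (C $$ (x, j div r) * D $$ (y, j mod r))"
  have "(kron A B * kron C D) $$ (i, j) = (\<Sum>k<b * q. ?f (k div q) (k mod q))"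
    using A B C D ij div_mod_less
    by (auto simp: kron_def scalar_prod_def atLeast0LessThan intro!: sum.cong)
  also have "\<dots> = (\<Sum>x<b. \<Sum>y<q. ?f x y)"
    by (rule sum_div_mod)
  also have "\<dots> = (\<Sum>x<b. A $$ (i div p, x) * C $$ (x, j div r)) * (\<Sum>y<q. B $$ (i mod p, y) * D $$ (y, j mod r))"
    unfolding sum_product by (intro sum.cong refl) (simp add: mult_ac)
  also have "\<dots> = kron (A * C) (B * D) $$ (i, j)"
    using A B C D ij dm by (simp add: kron_def scalar_prod_def atLeast0LessThan)
  finally show "(kron A B * kron C D) $$ (i, j) = kron (A * C) (B * D) $$ (i, j)" .
qed (use A B C D in \<open>auto simp: kron_def\<close>)

lemma kron_one: "kron (1\<^sub>m a) (1\<^sub>m b) = 1\<^sub>m (a * b)"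
proof (rule eq_matI)
  fix i j assume "i < dim_row (1\<^sub>m (a * b) :: 'a mat)" "j < dim_col (1\<^sub>m (a * b) :: 'a mat)"
  then have ij: "i < a * b" "j < a * b" by simp_all
  have "i = j \<longleftrightarrow> i div b = j div b \<and> i mod b = j mod b"
  proof
    assume eq: "i div b = j div b \<and> i mod b = j mod b"
    have "i = i div b * b + i mod b" by simp
    also have "\<dots> = j" unfolding conjunct1[OF eq] conjunct2[OF eq] by simp
    finally show "i = j" .
  qed simp
  then show "kron (1\<^sub>m a) (1\<^sub>m b) $$ (i, j) = (1\<^sub>m (a * b) :: 'a mat) $$ (i, j)"
    using ij div_mod_less[OF ij(1)] div_mod_less[OF ij(2)] by (auto simp: kron_def)
qed (auto simp: kron_def)

lemma kron_transpose: "transpose_mat (kron A B) = kron (transpose_mat A) (transpose_mat B)"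
proof (rule eq_matI)
  fix i j
  assume "i < dim_row (kron (transpose_mat A) (transpose_mat B))"
    "j < dim_col (kron (transpose_mat A) (transpose_mat B))"
  then have ij: "i < dim_col A * dim_col B" "j < dim_row A * dim_row B"
    by (simp_all add: kron_def)
  then show "transpose_mat (kron A B) $$ (i, j) = kron (transpose_mat A) (transpose_mat B) $$ (i, j)"
    using div_mod_less[OF ij(1)] div_mod_less[OF ij(2)] by (simp add: kron_def)
qed (simp_all add: kron_def)

primrec tpow :: "'a::comm_ring_1 mat \<Rightarrow> nat \<Rightarrow> 'a mat" where
  "tpow A 0 = 1\<^sub>m 1"
| "tpow A (Suc d) = kron A (tpow A d)"

lemma tpow_carrier: "A \<in> carrier_mat a b \<Longrightarrow> tpow A d \<in> carrier_mat (a ^ d) (b ^ d)"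
  by (induction d) (auto intro: kron_carrier)

lemma tpow_mult:
  assumes "A \<in> carrier_mat a b" "B \<in> carrier_mat b c"
  shows "tpow A d * tpow B d = tpow (A * B) d"
  by (induction d) (simp_all add: kron_mult[OF assms tpow_carrier[OF assms(1)] tpow_carrier[OF assms(2)]])

lemma tpow_one: "tpow (1\<^sub>m a) d = 1\<^sub>m (a ^ d)"
  by (induction d) (simp_all add: kron_one)

lemma tpow_transpose: "transpose_mat (tpow A d) = tpow (transpose_mat A) d"
  by (induction d) (simp_all add: kron_transpose)

lemma tpow_scalar:
  assumes "A \<in> carrier_mat 1 1"
  shows "tpow A d $$ (0, 0) = A $$ (0, 0) ^ d"
proof (induction d)
  case (Suc d)
  have "tpow A d \<in> carrier_mat 1 1" using tpow_carrier[OF assms, of d] by simp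
  then show ?case using assms Suc by (simp add: kron_def)
qed simp

section \<open>Tensor powers of vectors\<close>

definition colm :: "'a vec \<Rightarrow> 'a mat" where
  "colm v = mat (dim_vec v) 1 (\<lambda>(i, j). v $ i)"

lemma colm_carrier: "v \<in> carrier_vec n \<Longrightarrow> colm v \<in> carrier_mat n 1"
  by (auto simp: colm_def)

lemma colm_mult:
  assumes "A \<in> carrier_mat m n" "v \<in> carrier_vec n"
  shows "colm (A *\<^sub>v v) = A * colm v"
  using assms by (intro eq_matI) (auto simp: colm_def scalar_prod_def)

text \<open>The \<open>d\<close>-fold tensor product of \<open>v\<close> with itself. Regarding
  \<open>v\<close> as a one-column matrix lets the rules for \<open>tpow\<close> carry over to
  vectors.\<close>

definition tvec :: "nat \<Rightarrow> 'a::comm_ring_1 vec \<Rightarrow> 'a vec" where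
  "tvec d v = col (tpow (colm v) d) 0"

lemma tpow_colm_carrier: "v \<in> carrier_vec n \<Longrightarrow> tpow (colm v) d \<in> carrier_mat (n ^ d) 1"
  using tpow_carrier[OF colm_carrier, of v n d] by simp

lemma tvec_carrier: "v \<in> carrier_vec n \<Longrightarrow> tvec d v \<in> carrier_vec (n ^ d)"
  by (rule carrier_vecI) (simp add: tvec_def carrier_matD[OF tpow_colm_carrier])

lemma colm_tvec:
  assumes "v \<in> carrier_vec n"
  shows "colm (tvec d v) = tpow (colm v) d"
  using tpow_colm_carrier[OF assms, of d] by (intro eq_matI) (auto simp: colm_def tvec_def)

lemma colm_inject: "colm v = colm w \<Longrightarrow> v = w"
proof (rule eq_vecI)
  assume eq: "colm v = colm w"
  show dim: "dim_vec v = dim_vec w" using arg_cong[OF eq, of dim_row] by (simp add: colm_def)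
  show "v $ i = w $ i" if "i < dim_vec w" for i
    using arg_cong[OF eq, of "\<lambda>A. A $$ (i, 0)"] that dim by (simp add: colm_def)
qed

lemma tpow_mult_tvec:
  assumes A: "A \<in> carrier_mat n n" and v: "v \<in> carrier_vec n"
  shows "tpow A d *\<^sub>v tvec d v = tvec d (A *\<^sub>v v)"
proof (rule colm_inject)
  have "colm (tpow A d *\<^sub>v tvec d v) = tpow A d * tpow (colm v) d"
    unfolding colm_mult[OF tpow_carrier[OF A] tvec_carrier[OF v]] colm_tvec[OF v] ..
  also have "\<dots> = tpow (A * colm v) d"
    by (rule tpow_mult[OF A colm_carrier[OF v]])
  also have "\<dots> = colm (tvec d (A *\<^sub>v v))"
    using colm_tvec[of "A *\<^sub>v v" n d] A v by (simp add: colm_mult)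
  finally show "colm (tpow A d *\<^sub>v tvec d v) = colm (tvec d (A *\<^sub>v v))" .
qed

text \<open>A scalar product is the entry of a one-by-one matrix, for which the tensor power is an
  ordinary power.\<close>

lemma tvec_scalar_prod:
  assumes v: "v \<in> carrier_vec n" and w: "w \<in> carrier_vec n"
  shows "tvec d v \<bullet> tvec d w = (v \<bullet> w) ^ d"
proof -
  have *: "x \<bullet> y = (transpose_mat (colm x) * colm y) $$ (0, 0)"
    if "x \<in> carrier_vec k" "y \<in> carrier_vec k" for x y :: "'a vec" and k
    using that by (auto simp: colm_def scalar_prod_def intro!: sum.cong)
  have "tvec d v \<bullet> tvec d w = (transpose_mat (tpow (colm v) d) * tpow (colm w) d) $$ (0, 0)"
    unfolding *[OF tvec_carrier[OF v] tvec_carrier[OF w]] colm_tvec[OF v] colm_tvec[OF w] ..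
  also have "transpose_mat (tpow (colm v) d) * tpow (colm w) d = tpow (transpose_mat (colm v) * colm w) d"
    unfolding tpow_transpose
    by (rule tpow_mult) (use colm_carrier[OF v] colm_carrier[OF w] in auto)
  also have "\<dots> $$ (0, 0) = (transpose_mat (colm v) * colm w) $$ (0, 0) ^ d"
  proof (rule tpow_scalar)
    show "transpose_mat (colm v) * colm w \<in> carrier_mat 1 1"
      using colm_carrier[OF v] colm_carrier[OF w] by (intro mult_carrier_mat[of _ 1 n]) auto
  qed
  also have "\<dots> = (v \<bullet> w) ^ d"
    using *[OF v w] by simp
  finally show ?thesis .
qed

lemma tvec_entry:
  assumes "v \<in> carrier_vec n" "i < n ^ d"
  shows "tvec d v $ i = tpow (colm v) d $$ (i, 0)"
  using tpow_colm_carrier[OF assms(1), of d] assms(2) by (simp add: tvec_def)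

section \<open>A module with a large sigma number\<close>

lemma regular_onI:
  "p \<in> matrix_polys n \<Longrightarrow> (\<And>A. A \<in> G \<Longrightarrow> f A = eval_mat p A / det A ^ r) \<Longrightarrow> regular_on n G f"
  unfolding regular_on_def by blast

lemma regular_on_polyfun:
  fixes F :: "(nat \<times> nat \<Rightarrow> 'a::field) \<Rightarrow> 'a"
  assumes "polyfun ({..<n} \<times> {..<n}) F"
  shows "regular_on n G (\<lambda>A. F (($$) A) / det A ^ r)"
  using assms unfolding polyfun_def by (auto intro!: regular_onI)

lemma regular_on_const: "regular_on n G (\<lambda>A. c)"
  using regular_on_polyfun[OF polyfun_const, of n G c 0] by simp

lemma regular_on_mult:
  assumes "regular_on n G f" "regular_on n G h"
  shows "regular_on n G (\<lambda>A. f A * h A)"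
proof -
  obtain p r q s where "p \<in> matrix_polys n" "\<forall>A\<in>G. f A = eval_mat p A / det A ^ r"
    "q \<in> matrix_polys n" "\<forall>A\<in>G. h A = eval_mat q A / det A ^ s"
    using assms unfolding regular_on_def by blast
  then show ?thesis
    by (intro regular_onI[of "p * q" _ _ _ "r + s"])
      (simp_all add: mpolys_mult mpoly_eval_mult power_add)
qed

lemma polyfun_cofactor:
  fixes i j :: nat
  assumes "i < n" "j < n"
  shows "\<exists>F :: (nat \<times> nat \<Rightarrow> 'a::field) \<Rightarrow> 'a. polyfun ({..<n} \<times> {..<n}) F \<and>
    (\<forall>A\<in>carrier_mat n n. cofactor A i j = F (($$) A))"
proof -
  \<comment> \<open>The reindexing skips row \<open>i\<close> and column \<open>j\<close>, so the
    cofactor becomes a signed minor in the original entries.\<close>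
  let ?e = "\<lambda>i' j'. (if i' < i then i' else Suc i', if j' < j then j' else Suc j')"
  let ?F = "\<lambda>x :: nat \<times> nat \<Rightarrow> 'a. (- 1) ^ (i + j) * det (mat (n - 1) (n - 1) (\<lambda>(i', j'). x (?e i' j')))"
  have "polyfun ({..<n} \<times> {..<n}) ?F"
    using assms by (intro polyfun_mult polyfun_const polyfun_det polyfun_var) auto
  then show ?thesis
    by (intro exI[of _ ?F]) (auto simp: cofactor_def mat_delete_def)
qed

text \<open>The direct sum of the natural module and the \<open>d\<close>-th tensor power of its
  dual; the inverse transpose is the matrix of the dual action.\<close>

definition power_module :: "nat \<Rightarrow> nat \<Rightarrow> 'a::field mat \<Rightarrow> 'a mat" where
  "power_module n d g = four_block_mat g (0\<^sub>m n (n ^ d)) (0\<^sub>m (n ^ d) n)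
     (tpow (transpose_mat (inv\<^bsub>GL n\<^esub> g)) d)"

context
  fixes n :: nat and G :: "'a::field mat set"
  assumes G: "linear_algebraic_group n G"
begin

lemma group_carrier: "g \<in> G \<Longrightarrow> g \<in> carrier_mat n n"
  using subset_GL[OF G] GL_carrier_mat by blast

lemma inv_carrier: "g \<in> G \<Longrightarrow> inv\<^bsub>GL n\<^esub> g \<in> carrier_mat n n"
  using inv_in_group[OF G] group_carrier by blast

text \<open>Cramer's rule. It writes the entries of the inverse as polynomials divided by the
  determinant, which makes the dual action regular.\<close>

lemma inv_det:
  assumes "g \<in> G" "i < n" "j < n"
  shows "(inv\<^bsub>GL n\<^esub> g) $$ (i, j) = cofactor g j i / det g"
proof -
  let ?h = "inv\<^bsub>GL n\<^esub> g"
  note g = group_carrier[OF assms(1)] and h = inv_carrier[OF assms(1)]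
  have det: "det g \<noteq> 0" using subset_GL[OF G] assms(1) by (auto simp: carrier_GL)
  have adj: "adj_mat g \<in> carrier_mat n n" "adj_mat g * g = det g \<cdot>\<^sub>m 1\<^sub>m n"
    using adj_mat[OF g] by auto
  have "adj_mat g = adj_mat g * (g * ?h)"
    using adj(1) group_inv(1)[OF G assms(1)] by simp
  also have "\<dots> = (adj_mat g * g) * ?h"
    using assoc_mult_mat[OF adj(1) g h] by simp
  also have "\<dots> = det g \<cdot>\<^sub>m ?h"
    unfolding adj(2) using mult_smult_assoc_mat[of "1\<^sub>m n" n n ?h n "det g"] h by simp
  finally have "adj_mat g $$ (i, j) = det g * ?h $$ (i, j)"
    using h assms by simp
  then show ?thesis
    using det g assms by (simp add: adj_mat_def)
qed

lemma regular_on_inv: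
  assumes "i < n" "j < n"
  shows "regular_on n G (\<lambda>g. (inv\<^bsub>GL n\<^esub> g) $$ (i, j))"
proof -
  obtain F :: "(nat \<times> nat \<Rightarrow> 'a) \<Rightarrow> 'a" where F: "polyfun ({..<n} \<times> {..<n}) F"
    "\<forall>A\<in>carrier_mat n n. cofactor A j i = F (($$) A)"
    using polyfun_cofactor[OF assms(2,1)] by blast
  have "regular_on n G (\<lambda>A. F (($$) A) / det A ^ 1)"
    by (rule regular_on_polyfun[OF F(1)])
  moreover have "(inv\<^bsub>GL n\<^esub> g) $$ (i, j) = F (($$) g) / det g ^ 1" if "g \<in> G" for g
    using inv_det[OF that assms] F(2) group_carrier[OF that] by simp
  ultimately show ?thesis
    unfolding regular_on_def by simp
qed

lemma regular_on_tpow_inv: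
  assumes ij: "i < n ^ d" "j < n ^ d"
  shows "regular_on n G (\<lambda>g. tpow (transpose_mat (inv\<^bsub>GL n\<^esub> g)) d $$ (i, j))"
  using ij
proof (induction d arbitrary: i j)
  case 0
  then show ?case using regular_on_const[of n G 1] by simp
next
  case (Suc d)
  then have "i < n * n ^ d" "j < n * n ^ d" by simp_all
  note dm = div_mod_less[OF this(1)] div_mod_less[OF this(2)]
  have eq: "tpow (transpose_mat (inv\<^bsub>GL n\<^esub> g)) (Suc d) $$ (i, j) =
      (inv\<^bsub>GL n\<^esub> g) $$ (j div n ^ d, i div n ^ d)
        * tpow (transpose_mat (inv\<^bsub>GL n\<^esub> g)) d $$ (i mod n ^ d, j mod n ^ d)" if "g \<in> G" for g
  proof -
    have T: "transpose_mat (inv\<^bsub>GL n\<^esub> g) \<in> carrier_mat n n"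
      using inv_carrier[OF that] by simp
    then show ?thesis
      using tpow_carrier[OF T, of d] Suc.prems dm by (simp add: kron_def)
  qed
  have "regular_on n G (\<lambda>g. (inv\<^bsub>GL n\<^esub> g) $$ (j div n ^ d, i div n ^ d)
        * tpow (transpose_mat (inv\<^bsub>GL n\<^esub> g)) d $$ (i mod n ^ d, j mod n ^ d))"
    using dm by (intro regular_on_mult regular_on_inv Suc.IH) auto
  then show ?case
    using eq unfolding regular_on_def by simp
qed

lemma tpow_inv_carrier: "g \<in> G \<Longrightarrow> tpow (transpose_mat (inv\<^bsub>GL n\<^esub> g)) d \<in> carrier_mat (n ^ d) (n ^ d)"
  by (intro tpow_carrier) (simp add: inv_carrier)

lemma power_module_carrier: "g \<in> G \<Longrightarrow> power_module n d g \<in> carrier_mat (n + n ^ d) (n + n ^ d)"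
  unfolding power_module_def by (intro four_block_carrier_mat group_carrier tpow_inv_carrier)

text \<open>Inversion and transposition both reverse products, so together they preserve the order;
  \<open>tpow\<close> and block-diagonal matrices are multiplicative.\<close>

lemma power_module_mult:
  assumes g: "g \<in> G" and h: "h \<in> G"
  shows "power_module n d (g * h) = power_module n d g * power_module n d h"
proof -
  let ?i = "\<lambda>g. inv\<^bsub>GL n\<^esub> g"
  have "?i (g * h) = ?i h * ?i g"
    using group.inv_mult_group[OF group_GL, of g n h] g h subset_GL[OF G] by (auto simp: mult_GL)
  then have "transpose_mat (?i (g * h)) = transpose_mat (?i g) * transpose_mat (?i h)"
    using transpose_mult[OF inv_carrier[OF h] inv_carrier[OF g]] by simp
  then have T: "tpow (transpose_mat (?i (g * h))) d = tpow (transpose_mat (?i g)) d * tpow (transpose_mat (?i h)) d"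
    using tpow_mult[of "transpose_mat (?i g)" n n "transpose_mat (?i h)" n d]
      inv_carrier[OF g] inv_carrier[OF h] by simp
  note c = group_carrier[OF g] tpow_inv_carrier[OF g, of d] group_carrier[OF h] tpow_inv_carrier[OF h, of d]
  show ?thesis
    unfolding power_module_def T
    by (subst mult_four_block_mat[OF c(1) _ _ c(2) c(3) _ _ c(4)]) (use c in auto)
qed

lemma power_module_one: "power_module n d (1\<^sub>m n :: 'a mat) = 1\<^sub>m (n + n ^ d)"
proof -
  have "inv\<^bsub>GL n\<^esub> (1\<^sub>m n :: 'a mat) = 1\<^sub>m n"
    using monoid.inv_one[OF group.is_monoid[OF group_GL], of n, unfolded one_GL] .
  then show ?thesis by (simp add: power_module_def tpow_one)
qed

lemma G_module_power_module: "G_module n G (n + n ^ d) (power_module n d)"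
  unfolding G_module_def
proof (intro conjI allI impI)
  have "power_module n d g \<in> carrier (GL (n + n ^ d))" if g: "g \<in> G" for g
  proof -
    note h = inv_in_group[OF G g]
    \<comment> \<open>The image of the inverse inverts the image of \<open>g\<close>, so the
      determinant of the latter is nonzero.\<close>
    have "power_module n d g * power_module n d (inv\<^bsub>GL n\<^esub> g) = 1\<^sub>m (n + n ^ d)"
      using power_module_mult[OF g h] group_inv(1)[OF G g] power_module_one by simp
    then have "det (power_module n d g) * det (power_module n d (inv\<^bsub>GL n\<^esub> g)) = 1"
      using det_mult[OF power_module_carrier[OF g] power_module_carrier[OF h]] by (metis det_one)
    then show ?thesis
      using power_module_carrier[OF g] by (auto simp: carrier_GL)
  qed
  then show "power_module n d \<in> hom ((GL n)\<lparr>carrier := G\<rparr>) (GL (n + n ^ d))"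
    by (auto simp: hom_def mult_GL power_module_mult)
  fix i j assume ij: "i < n + n ^ d" "j < n + n ^ d"
  have "polyfun ({..<n} \<times> {..<n}) (\<lambda>x :: nat \<times> nat \<Rightarrow> 'a. x (i, j))" if "i < n" "j < n"
    using that by (intro polyfun_var) simp
  from regular_on_polyfun[OF this, of G 0]
  have upper: "regular_on n G (\<lambda>g. g $$ (i, j))" if "i < n" "j < n"
    using that by simp
  have entry: "power_module n d g $$ (i, j) =
      (if i < n then if j < n then g $$ (i, j) else 0
       else if j < n then 0 else tpow (transpose_mat (inv\<^bsub>GL n\<^esub> g)) d $$ (i - n, j - n))" if "g \<in> G" for g
    using ij group_carrier[OF that] tpow_inv_carrier[OF that, of d] by (auto simp: power_module_def)
  have "regular_on n G (\<lambda>g. if i < n then if j < n then g $$ (i, j) else 0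
       else if j < n then 0 else tpow (transpose_mat (inv\<^bsub>GL n\<^esub> g)) d $$ (i - n, j - n))"
    using upper regular_on_const[of n G 0] regular_on_tpow_inv[of "i - n" d "j - n"] ij
    by (cases "i < n"; cases "j < n") simp_all
  then show "regular_on n G (\<lambda>g. power_module n d g $$ (i, j))"
    using entry unfolding regular_on_def by simp
qed

lemma power_module_vec:
  assumes g: "g \<in> G" and w: "w \<in> carrier_vec n" and u: "u \<in> carrier_vec (n ^ d)"
  shows "power_module n d g *\<^sub>v (w @\<^sub>v u) =
    (g *\<^sub>v w) @\<^sub>v (tpow (transpose_mat (inv\<^bsub>GL n\<^esub> g)) d *\<^sub>v u)"
  unfolding power_module_def
  by (rule mult_mat_vec_split[OF group_carrier[OF g] tpow_inv_carrier[OF g] w u])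

end

section \<open>Coordinates of tensor powers and the invariant pairing\<close>

lemma expo_tvec:
  assumes l: "\<And>m. l m \<in> carrier_vec n" and expo: "\<And>j. j < n \<Longrightarrow> expo \<nu> (\<lambda>m. l m $ j)"
    and i: "i < n ^ d"
  shows "expo (\<nu> ^ d) (\<lambda>m. tvec d (l m) $ i)"
  unfolding tvec_entry[OF l i] using i
proof (induction d arbitrary: i)
  case 0
  then show ?case using expo_geometric[of 1 1] by simp
next
  case (Suc d)
  then have "i < n * n ^ d" by simp
  note dm = div_mod_less[OF this]
  \<comment> \<open>Each tensor factor contributes one coordinate of \<open>l m\<close>, and with it
    one factor \<open>\<nu>\<close> of the base.\<close>
  have "tpow (colm (l m)) (Suc d) $$ (i, 0) = l m $ (i div n ^ d) * tpow (colm (l m)) d $$ (i mod n ^ d, 0)" for m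
    using tpow_colm_carrier[OF l[of m], of d] carrier_vecD[OF l[of m]] Suc.prems dm
    by (simp add: kron_def colm_def)
  then show ?case
    using expo_mult[OF expo Suc.IH] dm by simp
qed

lemma tvec_polynomial:
  fixes n d i :: nat
  assumes "i < n ^ d"
  shows "\<exists>p :: (nat, 'a::field) mpoly. p \<in> mpolys {..<n} \<and> (\<forall>v\<in>carrier_vec n. eval_vec p v = tvec d v $ i)"
proof -
  have "\<exists>p :: (nat, 'a) mpoly. p \<in> mpolys {..<n} \<and> (\<forall>v\<in>carrier_vec n. eval_vec p v = tpow (colm v) d $$ (i, 0))"
    using assms
  proof (induction d arbitrary: i)
    case 0
    then show ?case by (intro exI[of _ 1]) (auto intro: mpolys_1)
  next
    case (Suc d)
    then have "i < n * n ^ d" by simp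
    note dm = div_mod_less[OF this]
    obtain p :: "(nat, 'a) mpoly" where p: "p \<in> mpolys {..<n}"
      "\<forall>v\<in>carrier_vec n. eval_vec p v = tpow (colm v) d $$ (i mod n ^ d, 0)"
      using Suc.IH[of "i mod n ^ d"] dm by blast
    let ?q = "Poly_Mapping.single (Poly_Mapping.single (i div n ^ d) 1) 1 * p"
    have "eval_vec ?q v = tpow (colm v) (Suc d) $$ (i, 0)" if v: "v \<in> carrier_vec n" for v
      using tpow_colm_carrier[OF v, of d] carrier_vecD[OF v] Suc.prems dm p(2) v
      by (simp add: kron_def colm_def mpoly_eval_mult mon_eval_single_1[unfolded One_nat_def])
    moreover have "?q \<in> mpolys {..<n}"
      using p(1) dm by (intro mpolys_mult mpolys_single) auto
    ultimately show ?case by blast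
  qed
  then show ?thesis using assms by (auto simp: tvec_entry)
qed

text \<open>The contraction of a \<open>d\<close>-fold dual tensor with the \<open>d\<close>-th
  tensor power of a vector. Being linear in \<open>u\<close>, it has no constant term.\<close>

lemma pairing_polynomial:
  fixes n d :: nat
  shows "\<exists>p :: (nat, 'a::field) mpoly. p \<in> mpolys {..<n + n ^ d} \<and> const_term p = 0 \<and>
    (\<forall>w\<in>carrier_vec n. \<forall>u\<in>carrier_vec (n ^ d). eval_vec p (w @\<^sub>v u) = u \<bullet> tvec d w)"
proof -
  have "\<forall>i\<in>{..<n ^ d}. \<exists>p :: (nat, 'a) mpoly. p \<in> mpolys {..<n} \<and>
      (\<forall>v\<in>carrier_vec n. eval_vec p v = tvec d v $ i)"
    by (intro ballI tvec_polynomial) simp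
  from bchoice[OF this] obtain P :: "nat \<Rightarrow> (nat, 'a) mpoly" where
    P: "\<forall>i\<in>{..<n ^ d}. P i \<in> mpolys {..<n} \<and> (\<forall>v\<in>carrier_vec n. eval_vec (P i) v = tvec d v $ i)" ..
  \<comment> \<open>The variable \<open>n + i\<close> is the \<open>i\<close>-th coordinate of the
    second summand.\<close>
  let ?p = "\<Sum>i<n ^ d. Poly_Mapping.single (Poly_Mapping.single (n + i) 1) 1 * P i"
  have eval: "mpoly_eval ?p x = (\<Sum>i<n ^ d. x (n + i) * mpoly_eval (P i) x)" for x
    by (simp add: mpoly_eval_sum mpoly_eval_mult mon_eval_single_1[unfolded One_nat_def])
  have "eval_vec ?p (w @\<^sub>v u) = u \<bullet> tvec d w"
    if w: "w \<in> carrier_vec n" and u: "u \<in> carrier_vec (n ^ d)" for w u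
  proof -
    have "eval_vec (P i) (w @\<^sub>v u) = tvec d w $ i" if "i < n ^ d" for i
    proof -
      have "eval_vec (P i) (w @\<^sub>v u) = eval_vec (P i) w"
        by (rule mpoly_eval_cong[of _ "{..<n}"]) (use P that w u in auto)
      then show ?thesis using P that w by simp
    qed
    then show ?thesis
      unfolding eval using w u tvec_carrier[OF w, of d]
      by (auto simp: scalar_prod_def atLeast0LessThan intro!: sum.cong)
  qed
  moreover have "const_term ?p = 0"
    unfolding mpoly_eval_at_0[symmetric] eval by simp
  moreover have "?p \<in> mpolys {..<n + n ^ d}"
    using P by (intro mpolys_sum mpolys_mult mpolys_single) (auto intro: mpolys_mono)
  ultimately show ?thesis by blast
qed

text \<open>The transposed inverse acting on \<open>u\<close> moves across the scalar product and
  cancels the action on \<open>w\<close>.\<close>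

lemma pairing_invariant:
  fixes G :: "'a::field mat set"
  assumes G: "linear_algebraic_group n G"
  shows "\<exists>p\<in>plus_part (invariants n G (n + n ^ d) (power_module n d)).
    \<forall>w\<in>carrier_vec n. \<forall>u\<in>carrier_vec (n ^ d). eval_vec p (w @\<^sub>v u) = u \<bullet> tvec d w"
proof -
  obtain p :: "(nat, 'a) mpoly" where p: "p \<in> mpolys {..<n + n ^ d}" "const_term p = 0"
    "\<forall>w\<in>carrier_vec n. \<forall>u\<in>carrier_vec (n ^ d). eval_vec p (w @\<^sub>v u) = u \<bullet> tvec d w"
    using pairing_polynomial by blast
  have inv: "eval_vec p (power_module n d h *\<^sub>v v) = eval_vec p v"
    if h: "h \<in> G" and v: "v \<in> carrier_vec (n + n ^ d)" for h v
  proof -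
    define w where "w = vec_first v n"
    define u where "u = vec_last v (n ^ d)"
    have w: "w \<in> carrier_vec n" and u: "u \<in> carrier_vec (n ^ d)"
      by (simp_all add: w_def u_def)
    have vwu: "v = w @\<^sub>v u" using v by (simp add: w_def u_def)
    let ?i = "inv\<^bsub>GL n\<^esub> h"
    note hc = group_carrier[OF G h] and ic = inv_carrier[OF G h]
    have hw: "h *\<^sub>v w \<in> carrier_vec n" using hc w by simp
    have Tu: "tpow (transpose_mat ?i) d *\<^sub>v u \<in> carrier_vec (n ^ d)"
      using tpow_inv_carrier[OF G h] u by (rule mult_mat_vec_carrier)
    have "eval_vec p (power_module n d h *\<^sub>v v) = (tpow (transpose_mat ?i) d *\<^sub>v u) \<bullet> tvec d (h *\<^sub>v w)"
      unfolding vwu power_module_vec[OF G h w u] using p(3) hw Tu by blast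
    also have "\<dots> = (transpose_mat (tpow ?i d) *\<^sub>v u) \<bullet> tvec d (h *\<^sub>v w)"
      unfolding tpow_transpose ..
    also have "\<dots> = u \<bullet> (tpow ?i d *\<^sub>v tvec d (h *\<^sub>v w))"
      by (rule transpose_vec_mult_scalar[OF tpow_carrier[OF ic] tvec_carrier[OF hw] u])
    also have "tpow ?i d *\<^sub>v tvec d (h *\<^sub>v w) = tvec d (?i *\<^sub>v (h *\<^sub>v w))"
      by (rule tpow_mult_tvec[OF ic hw])
    also have "?i *\<^sub>v (h *\<^sub>v w) = w"
      using assoc_mult_mat_vec[OF ic hc w] group_inv(2)[OF G h] w by simp
    finally show ?thesis using p(3) w u vwu by simp
  qed
  \<comment> \<open>In \<open>invariants\<close> it is the inverse of a group element that acts;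
    \<open>inv\<close> holds for every \<open>h\<close> in \<open>G\<close>, in particular for this
    inverse.\<close>
  have "p \<in> invariants n G (n + n ^ d) (power_module n d)"
    unfolding invariants_def using p(1) inv inv_in_group[OF G] by blast
  then show ?thesis using p(2,3) unfolding plus_part_def by blast
qed

section \<open>Weights of monomials and the lower bound\<close>

lemma total_degree_le_iff:
  "total_degree p \<le> d \<longleftrightarrow>
    (\<forall>t\<in>Poly_Mapping.keys p. (\<Sum>i\<in>Poly_Mapping.keys t. Poly_Mapping.lookup t i) \<le> d)"
  unfolding total_degree_def by (subst Max_le_iff) auto

text \<open>
  With weights \<open>t\<close> on the first \<open>n\<close> coordinates and \<open>t ^ (-d)\<close> on the others, a nonconstant
  monomial of degree at most \<open>d\<close> never has weight \<open>1\<close>.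
\<close>

lemma weight_neq_1:
  fixes t :: "'a::field"
  assumes t: "t \<noteq> 0" and order: "\<And>k. 0 < k \<Longrightarrow> k \<le> d * d \<Longrightarrow> t ^ k \<noteq> 1"
    and ab: "0 < a + b" "a + b \<le> d"
  shows "t ^ a * (inverse t ^ d) ^ b \<noteq> 1"
proof (cases "b = 0")
  case True
  have "d \<le> d * d" by simp
  then have "a \<le> d * d" using ab(2) True by linarith
  then show ?thesis using order[of a] ab(1) True by simp
next
  case False
  \<comment> \<open>For \<open>b > 0\<close> weight \<open>1\<close> would equate the powers of
    \<open>t\<close> with exponents \<open>a\<close> and \<open>d * b\<close>. Their distance is
    positive and at most \<open>d * d\<close>, the range in which no power of \<open>t\<close> is
    \<open>1\<close>.\<close>
  have db: "a < d * b" "d * b \<le> d * d"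
  proof -
    have "a < d" using ab(2) False by linarith
    also have "d \<le> d * b" using False by simp
    finally show "a < d * b" .
    show "d * b \<le> d * d" using ab(2) by simp
  qed
  show ?thesis
  proof
    assume "t ^ a * (inverse t ^ d) ^ b = 1"
    then have "t ^ a = t ^ (d * b)"
      using t by (simp add: power_mult[symmetric] power_inverse field_simps)
    also have "\<dots> = t ^ a * t ^ (d * b - a)"
      using db(1) by (simp add: power_add[symmetric])
    finally have "t ^ (d * b - a) = 1" using t by simp
    then show False using order[of "d * b - a"] db by simp
  qed
qed

text \<open>The vector \<open>v 0\<close> is detected by the pairing, but by no invariant of degree
  at most \<open>d\<close> without constant term. Since being a sigma-set persists when the degree
  bound grows, every admissible degree exceeds \<open>d\<close>.\<close>

lemma sigma_power_module:
  fixes G :: "'a::field mat set"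
  assumes G: "linear_algebraic_group n G" and g: "g \<in> G" and root: "poly (char_poly g) t = 0"
    and order: "\<And>k. 0 < k \<Longrightarrow> k \<le> d * d \<Longrightarrow> t ^ k \<noteq> 1"
  shows "enat d < sigma_module n G (n + n ^ d) (power_module n d)"
proof -
  let ?m = "n + n ^ d" and ?\<rho> = "power_module n d" and ?i = "inv\<^bsub>GL n\<^esub> g"
  let ?B = "transpose_mat ?i"
  note gc = group_carrier[OF G g] and ic = inv_carrier[OF G g]
  have Bc: "?B \<in> carrier_mat n n" using ic by simp
  obtain w where w: "w \<in> carrier_vec n" "w \<noteq> 0\<^sub>v n" "g *\<^sub>v w = t \<cdot>\<^sub>v w"
    using root unfolding eigenvalue_root_char_poly[OF gc, symmetric] eigenvalue_def eigenvector_def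
    using gc by auto
  \<comment> \<open>This identity serves twice: it excludes \<open>t = 0\<close>, and it makes
    \<open>w\<close> an eigenvector of \<open>?i\<close> for \<open>inverse t\<close>.\<close>
  have w_eq: "w = t \<cdot>\<^sub>v (?i *\<^sub>v w)"
  proof -
    have "w = ?i *\<^sub>v (g *\<^sub>v w)"
      using assoc_mult_mat_vec[OF ic gc w(1)] group_inv(2)[OF G g] w(1) by simp
    then show ?thesis unfolding w(3) using mult_mat_vec[OF ic w(1)] by simp
  qed
  have t: "t \<noteq> 0"
  proof
    assume "t = 0"
    then have "w = 0 \<cdot>\<^sub>v (?i *\<^sub>v w)" using w_eq by simp
    also have "\<dots> = 0\<^sub>v n"
      using carrier_vecD[OF mult_mat_vec_carrier[OF ic w(1)]] by (intro eq_vecI) auto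
    finally show False using w(2) by simp
  qed
  have iw: "?i *\<^sub>v w = inverse t \<cdot>\<^sub>v w"
    using arg_cong[OF w_eq, of "\<lambda>x. inverse t \<cdot>\<^sub>v x"] t by (simp add: smult_smult_assoc)
  \<comment> \<open>A generalized eigenvector of the dual action for \<open>inverse t\<close>. The
    pairing with \<open>w\<close> must not vanish, since its \<open>d\<close>-th power is the value
    of the invariant pairing at \<open>v 0\<close>.\<close>
  obtain l where l: "l \<in> carrier_vec n" "w \<bullet> l \<noteq> 0"
    "\<forall>j<n. expo (inverse t) (\<lambda>k. (?B ^\<^sub>m k *\<^sub>v l) $ j)"
    using left_generalized_eigenvector[OF ic w(1,2) iw] by blast
  define L where "L k = ?B ^\<^sub>m k *\<^sub>v l" for k
  have L: "L k \<in> carrier_vec n" for k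
    unfolding L_def using pow_carrier_mat[OF Bc] l(1) by (rule mult_mat_vec_carrier)
  \<comment> \<open>The orbit of \<open>v 0\<close> under the powers of \<open>g\<close>.\<close>
  define v where "v k = (t ^ k \<cdot>\<^sub>v w) @\<^sub>v tvec d (L k)" for k
  have vc: "v k \<in> carrier_vec ?m" for k
    unfolding v_def using w(1) tvec_carrier[OF L] by simp
  have step: "?\<rho> g *\<^sub>v v k = v (Suc k)" for k
  proof -
    have "g *\<^sub>v (t ^ k \<cdot>\<^sub>v w) = t ^ Suc k \<cdot>\<^sub>v w"
      using mult_mat_vec[OF gc w(1)] w(3) by (simp add: smult_smult_assoc mult.commute)
    moreover have "?B *\<^sub>v L k = L (Suc k)"
      unfolding L_def pow_mat_Suc_left[OF Bc] using assoc_mult_mat_vec[OF Bc pow_carrier_mat[OF Bc] l(1)] by simp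
    moreover have "tpow ?B d *\<^sub>v tvec d (L k) = tvec d (?B *\<^sub>v L k)"
      by (rule tpow_mult_tvec[OF Bc L])
    ultimately show ?thesis
      unfolding v_def using power_module_vec[OF G g _ tvec_carrier[OF L]] w(1) by simp
  qed
  have "v 0 \<notin> nullcone n G ?m ?\<rho>"
  proof -
    obtain p where p: "p \<in> plus_part (invariants n G ?m ?\<rho>)"
      "\<forall>w\<in>carrier_vec n. \<forall>u\<in>carrier_vec (n ^ d). eval_vec p (w @\<^sub>v u) = u \<bullet> tvec d w"
      using pairing_invariant[OF G] by blast
    have "eval_vec p (v 0) = tvec d (L 0) \<bullet> tvec d w"
      using p(2) w(1) tvec_carrier[OF L] by (simp add: v_def)
    also have "\<dots> = (L 0 \<bullet> w) ^ d"
      by (rule tvec_scalar_prod[OF L w(1)])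
    also have "L 0 = l" using l(1) ic by (simp add: L_def)
    finally have "eval_vec p (v 0) \<noteq> 0"
      using l(1,2) w(1) by (simp add: comm_scalar_prod[of l n])
    then show ?thesis using p(1) unfolding nullcone_def by blast
  qed
  moreover have "eval_vec f (v 0) = 0" if f: "f \<in> plus_part (invariants_le n G ?m ?\<rho> d)" for f
  proof -
    have f_inv: "f \<in> invariants n G ?m ?\<rho>" and deg: "total_degree f \<le> d" and f0: "const_term f = 0"
      using f by (auto simp: plus_part_def invariants_le_def)
    have fI: "f \<in> mpolys {..<?m}" using f_inv by (simp add: invariants_def)
    \<comment> \<open>Invariance is phrased with an inverse, so it is applied to \<open>?i\<close>
      in order to let \<open>g\<close> itself act.\<close>
    have "inv\<^bsub>GL n\<^esub> ?i = g"
      using subset_GL[OF G] g by (intro group.inv_inv[OF group_GL]) blast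
    then have "eval_vec f (?\<rho> g *\<^sub>v x) = eval_vec f x" if "x \<in> carrier_vec ?m" for x
      using f_inv that inv_in_group[OF G g] unfolding invariants_def by force
    then have const: "eval_vec f (v k) = eval_vec f (v 0)" for k
      by (induction k) (simp_all add: step[symmetric] vc)
    \<comment> \<open>The base of the sequence that the \<open>i\<close>-th coordinate forms along
      the orbit.\<close>
    define \<mu> where "\<mu> i = (if i < n then t else inverse t ^ d)" for i
    have coord: "expo (\<mu> i) (\<lambda>k. v k $ i)" if "i < ?m" for i
    proof (cases "i < n")
      case True
      then have "(\<lambda>k. v k $ i) = (\<lambda>k. w $ i * t ^ k)"
        using w(1) tvec_carrier[OF L] by (auto simp: v_def)
      then show ?thesis using expo_geometric True by (simp add: \<mu>_def)
    next
      case False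
      then have "(\<lambda>k. v k $ i) = (\<lambda>k. tvec d (L k) $ (i - n))"
        using w(1) carrier_vecD[OF tvec_carrier[OF L]] that by (auto simp: v_def)
      moreover have "expo (inverse t ^ d) (\<lambda>k. tvec d (L k) $ (i - n))"
        using l(3) False that by (intro expo_tvec[OF L]) (auto simp: L_def)
      ultimately show ?thesis using False by (simp add: \<mu>_def)
    qed
    show ?thesis
    proof (rule constant_sum_expo_eq_0)
      show "finite (Poly_Mapping.keys f)" by simp
      show "(\<Sum>s\<in>Poly_Mapping.keys f. Poly_Mapping.lookup f s * mon_eval s (($) (v k))) = eval_vec f (v 0)" for k
        using const[of k] by (simp only: mpoly_eval_def)
      fix s assume s: "s \<in> Poly_Mapping.keys f"
      let ?K = "Poly_Mapping.keys s" and ?e = "Poly_Mapping.lookup s"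
      have K: "?K \<subseteq> {..<?m}" using fI s by (simp add: mpolys_def)
      \<comment> \<open>The absence of a constant term rules out the trivial monomial, the only one
        of degree at most \<open>d\<close> with weight \<open>1\<close>.\<close>
      have s0: "s \<noteq> 0" using s f0 by (auto simp: in_keys_iff)
      have "expo (\<Prod>i\<in>?K. \<mu> i ^ ?e i) (\<lambda>k. \<Prod>i\<in>?K. v k $ i ^ ?e i)"
        using K by (intro expo_prod expo_power coord) auto
      then have "expo (\<Prod>i\<in>?K. \<mu> i ^ ?e i) (\<lambda>k. Poly_Mapping.lookup f s * mon_eval s (($) (v k)))"
        unfolding mon_eval_def by (rule expo_cmult)
      moreover have "(\<Prod>i\<in>?K. \<mu> i ^ ?e i) \<noteq> 1"
      proof -
        let ?a = "\<Sum>i\<in>?K \<inter> {..<n}. ?e i" and ?b = "\<Sum>i\<in>?K - {..<n}. ?e i"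
        have sum: "?a + ?b = (\<Sum>i\<in>?K. ?e i)"
          by (rule sum.Int_Diff[symmetric]) simp
        have le: "?a + ?b \<le> d"
          using deg s unfolding sum total_degree_le_iff by blast
        have pos: "0 < ?a + ?b"
          unfolding sum using s0 by (intro sum_pos) (auto simp: in_keys_iff)
        have "t ^ ?a * (inverse t ^ d) ^ ?b \<noteq> 1"
          by (rule weight_neq_1[OF t _ pos le]) (rule order)
        moreover have "(\<Prod>i\<in>?K. \<mu> i ^ ?e i) = (\<Prod>i\<in>?K \<inter> {..<n}. \<mu> i ^ ?e i) * (\<Prod>i\<in>?K - {..<n}. \<mu> i ^ ?e i)"
          by (rule prod.Int_Diff) simp
        moreover have "(\<Prod>i\<in>?K \<inter> {..<n}. \<mu> i ^ ?e i) = t ^ ?a" "(\<Prod>i\<in>?K - {..<n}. \<mu> i ^ ?e i) = (inverse t ^ d) ^ ?b"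
          unfolding power_sum by (auto simp: \<mu>_def intro!: prod.cong)
        ultimately show ?thesis by simp
      qed
      ultimately show "\<exists>\<mu>. \<mu> \<noteq> 1 \<and> expo \<mu> (\<lambda>k. Poly_Mapping.lookup f s * mon_eval s (($) (v k)))"
        by blast
    qed
  qed
  ultimately have none: "\<not> sigma_set n G ?m ?\<rho> (invariants_le n G ?m ?\<rho> d)"
    using vc[of 0] by (auto simp: sigma_set_def intro!: bexI[of _ "v 0"])
  have "enat (Suc d) \<le> e" if e: "e \<in> {enat d' |d'. sigma_set n G ?m ?\<rho> (invariants_le n G ?m ?\<rho> d')}" for e
  proof -
    obtain d' where d': "e = enat d'" "sigma_set n G ?m ?\<rho> (invariants_le n G ?m ?\<rho> d')"
      using e by blast
    \<comment> \<open>A set of invariants that contains a sigma-set is itself one, so an admissible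
      \<open>d'\<close> up to \<open>d\<close> would make \<open>d\<close> admissible.\<close>
    have "\<not> d' \<le> d"
    proof
      assume "d' \<le> d"
      then have "invariants_le n G ?m ?\<rho> d' \<subseteq> invariants_le n G ?m ?\<rho> d"
        by (auto simp: invariants_le_def)
      moreover have "invariants_le n G ?m ?\<rho> d \<subseteq> invariants n G ?m ?\<rho>"
        by (auto simp: invariants_le_def)
      ultimately have "sigma_set n G ?m ?\<rho> (invariants_le n G ?m ?\<rho> d)"
        using d'(2) unfolding sigma_set_def plus_part_def by fast
      then show False using none by simp
    qed
    then show ?thesis by (simp add: d'(1))
  qed
  then have "enat (Suc d) \<le> sigma_module n G ?m ?\<rho>"
    unfolding sigma_module_def by (rule Inf_greatest)
  then show ?thesis
    by (simp add: Suc_ile_eq)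
qed

section \<open>Finite groups\<close>

definition mon_degree :: "('i \<Rightarrow>\<^sub>0 nat) \<Rightarrow> nat" where
  "mon_degree t = (\<Sum>i\<in>Poly_Mapping.keys t. Poly_Mapping.lookup t i)"

lemma mon_degree_superset:
  "finite I \<Longrightarrow> Poly_Mapping.keys t \<subseteq> I \<Longrightarrow> mon_degree t = (\<Sum>i\<in>I. Poly_Mapping.lookup t i)"
  unfolding mon_degree_def by (rule sum.mono_neutral_left) (auto simp: in_keys_iff)

lemma mon_degree_add: "mon_degree (s + t) = mon_degree s + mon_degree t"
proof -
  let ?I = "Poly_Mapping.keys s \<union> Poly_Mapping.keys t"
  have "mon_degree (s + t) = (\<Sum>i\<in>?I. Poly_Mapping.lookup (s + t) i)"
    by (rule mon_degree_superset) (auto dest: set_mp[OF Poly_Mapping.keys_add])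
  also have "\<dots> = (\<Sum>i\<in>?I. Poly_Mapping.lookup s i) + (\<Sum>i\<in>?I. Poly_Mapping.lookup t i)"
    by (simp add: lookup_add sum.distrib)
  also have "\<dots> = mon_degree s + mon_degree t"
    by (simp add: mon_degree_superset[of ?I])
  finally show ?thesis .
qed

lemma total_degree_le_mon_degree:
  "total_degree p \<le> d \<longleftrightarrow> (\<forall>t\<in>Poly_Mapping.keys p. mon_degree t \<le> d)"
  by (simp add: total_degree_le_iff mon_degree_def)

lemma total_degree_mult_le:
  assumes "total_degree p \<le> a" "total_degree q \<le> b"
  shows "total_degree (p * q) \<le> a + b"
  unfolding total_degree_le_mon_degree
proof
  fix t assume "t \<in> Poly_Mapping.keys (p * q)"
  then obtain r s where "r \<in> Poly_Mapping.keys p" "s \<in> Poly_Mapping.keys q" "t = r + s"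
    using keys_mult[of p q] by auto
  then show "mon_degree t \<le> a + b"
    using assms unfolding total_degree_le_mon_degree by (auto simp: mon_degree_add intro: add_mono)
qed

lemma total_degree_prod_le:
  assumes "\<And>a. a \<in> A \<Longrightarrow> total_degree (f a) \<le> 1"
  shows "total_degree (\<Prod>a\<in>A. f a) \<le> card A"
  using assms
proof (induction A rule: infinite_finite_induct)
  case (insert a A)
  then show ?case
    using total_degree_mult_le[of "f a" 1 "prod f A" "card A"] by simp
qed (simp_all add: total_degree_def)

lemma total_degree_sum_le:
  "(\<And>a. a \<in> A \<Longrightarrow> total_degree (f a) \<le> d) \<Longrightarrow> total_degree (\<Sum>a\<in>A. f a) \<le> d"
proof (induction A rule: infinite_finite_induct)
  case (insert a A)
  then show ?case
    using Poly_Mapping.keys_add[of "f a" "sum f A"] unfolding total_degree_le_mon_degree by fastforce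
qed (simp_all add: total_degree_le_mon_degree)

section \<open>Norms of generic linear forms\<close>

lemma generic_linear_form:
  fixes U :: "'a::field vec set"
  assumes inf: "infinite (UNIV :: 'a set)" and U: "finite U" "\<And>u. u \<in> U \<Longrightarrow> u \<in> carrier_vec m \<and> u \<noteq> 0\<^sub>v m"
  shows "\<exists>c\<in>carrier_vec m. \<forall>u\<in>U. c \<bullet> u \<noteq> 0"
proof -
  \<comment> \<open>As a polynomial in \<open>t\<close>, this is the pairing of \<open>u\<close>
    with the point of the moment curve at parameter \<open>t\<close>. Each nonzero \<open>u\<close>
    excludes finitely many parameters, so one parameter is good for all of \<open>U\<close>.\<close>
  define P where "P u = (\<Sum>i<m. monom (u $ i) i)" for u :: "'a vec"
  have "P u \<noteq> 0" if "u \<in> U" for u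
  proof
    assume "P u = 0"
    have "coeff (P u) i = u $ i" if "i < m" for i
      using that by (simp add: P_def coeff_sum)
    then have "u = 0\<^sub>v m"
      using \<open>P u = 0\<close> U(2)[OF \<open>u \<in> U\<close>] by (intro eq_vecI) auto
    then show False using U(2)[OF that] by simp
  qed
  then have "finite (\<Union>u\<in>U. {t. poly (P u) t = 0})"
    using U(1) by (auto intro: poly_roots_finite)
  then obtain t where "t \<notin> (\<Union>u\<in>U. {t. poly (P u) t = 0})"
    using inf by (meson ex_new_if_finite)
  moreover have "vec m (\<lambda>i. t ^ i) \<bullet> u = poly (P u) t" if "u \<in> U" for u
    using U(2)[OF that]
    by (auto simp: P_def scalar_prod_def poly_sum poly_monom atLeast0LessThan mult.commute intro!: sum.cong)
  ultimately show ?thesis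
    by (intro bexI[of _ "vec m (\<lambda>i. t ^ i)"]) auto
qed

lemma linear_polynomial:
  fixes a :: "'a::field vec"
  assumes a: "a \<in> carrier_vec m"
  shows "\<exists>p\<in>mpolys {..<m}. total_degree p \<le> 1 \<and> const_term p = 0 \<and>
    (\<forall>v\<in>carrier_vec m. eval_vec p v = a \<bullet> v)"
proof -
  let ?p = "\<Sum>i<m. Poly_Mapping.single (Poly_Mapping.single i 1) (a $ i)"
  have eval: "mpoly_eval ?p x = (\<Sum>i<m. a $ i * x i)" for x
    by (simp add: mpoly_eval_sum mon_eval_single_1[unfolded One_nat_def])
  have "?p \<in> mpolys {..<m}"
    by (intro mpolys_sum mpolys_single) auto
  moreover have "total_degree ?p \<le> 1"
    by (rule total_degree_sum_le) (auto simp: total_degree_le_mon_degree mon_degree_def)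
  moreover have "const_term ?p = 0"
    unfolding mpoly_eval_at_0[symmetric] eval by simp
  moreover have "\<forall>v\<in>carrier_vec m. eval_vec ?p v = a \<bullet> v"
    unfolding eval by (auto simp: scalar_prod_def atLeast0LessThan)
  ultimately show ?thesis by blast
qed

text \<open>The invariant is the norm of a linear form \<open>c\<close>, the product of its
  translates by all \<open>g\<close> in \<open>G\<close>. Since \<open>c\<close> is chosen nonzero
  at every point of the finite orbit of \<open>v\<close>, the norm does not vanish at
  \<open>v\<close>.\<close>

lemma sigma_set_finite_group:
  fixes G :: "'a::field mat set"
  assumes inf: "infinite (UNIV :: 'a set)" and G: "linear_algebraic_group n G" and fin: "finite G"
    and \<rho>: "G_module n G m \<rho>"
  shows "sigma_set n G m \<rho> (invariants_le n G m \<rho> (card G))"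
  unfolding sigma_set_def
proof (intro conjI ballI)
  show "invariants_le n G m \<rho> (card G) \<subseteq> invariants n G m \<rho>"
    by (auto simp: invariants_le_def)
  fix v assume v: "v \<in> carrier_vec m - nullcone n G m \<rho>"
  have hom: "\<rho> \<in> hom ((GL n)\<lparr>carrier := G\<rparr>) (GL m)"
    using \<rho> by (simp add: G_module_def)
  have \<rho>c: "\<rho> g \<in> carrier_mat m m" if "g \<in> G" for g
    using hom that by (auto simp: hom_def carrier_GL)
  have \<rho>mult: "\<rho> (g * h) = \<rho> g * \<rho> h" if "g \<in> G" "h \<in> G" for g h
    using hom that by (auto simp: hom_def mult_GL)
  \<comment> \<open>The origin lies in the nullcone, because an invariant without constant term
    vanishes there.\<close>
  have v0: "v \<noteq> 0\<^sub>v m"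
  proof
    assume v0: "v = 0\<^sub>v m"
    have "eval_vec f v = 0" if "f \<in> plus_part (invariants n G m \<rho>)" for f
    proof -
      have f: "f \<in> mpolys {..<m}" "const_term f = 0"
        using that by (auto simp: plus_part_def invariants_def)
      have "eval_vec f v = mpoly_eval f (\<lambda>_. 0)"
        by (rule mpoly_eval_cong[OF f(1)]) (simp add: v0)
      then show ?thesis using f(2) by (simp add: mpoly_eval_at_0)
    qed
    then show False using v by (auto simp: nullcone_def)
  qed
  have "\<rho> g *\<^sub>v v \<in> carrier_vec m \<and> \<rho> g *\<^sub>v v \<noteq> 0\<^sub>v m" if g: "g \<in> G" for g
  proof
    show "\<rho> g *\<^sub>v v \<in> carrier_vec m"
      using \<rho>c[OF g] v by (intro mult_mat_vec_carrier) auto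
    have "det (\<rho> g) \<noteq> 0"
      using hom g by (auto simp: hom_def carrier_GL)
    then show "\<rho> g *\<^sub>v v \<noteq> 0\<^sub>v m"
      using det_0_iff_vec_prod_zero_field[OF \<rho>c[OF g]] v v0 by blast
  qed
  then have "\<exists>c\<in>carrier_vec m. \<forall>u\<in>(\<lambda>g. \<rho> g *\<^sub>v v) ` G. c \<bullet> u \<noteq> 0"
    by (intro generic_linear_form inf finite_imageI fin) auto
  then obtain c where c: "c \<in> carrier_vec m" "\<forall>g\<in>G. c \<bullet> (\<rho> g *\<^sub>v v) \<noteq> 0"
    by blast
  have "\<forall>g\<in>G. \<exists>p. p \<in> mpolys {..<m} \<and> total_degree p \<le> 1 \<and> const_term p = 0 \<and>
      (\<forall>x\<in>carrier_vec m. eval_vec p x = c \<bullet> (\<rho> g *\<^sub>v x))"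
  proof
    fix g assume g: "g \<in> G"
    have T: "transpose_mat (\<rho> g) *\<^sub>v c \<in> carrier_vec m"
      using \<rho>c[OF g] c(1) by (intro mult_mat_vec_carrier[of _ m m]) auto
    have "(transpose_mat (\<rho> g) *\<^sub>v c) \<bullet> x = c \<bullet> (\<rho> g *\<^sub>v x)" if "x \<in> carrier_vec m" for x
      by (rule transpose_vec_mult_scalar[OF \<rho>c[OF g] that c(1)])
    then show "\<exists>p. p \<in> mpolys {..<m} \<and> total_degree p \<le> 1 \<and> const_term p = 0 \<and>
      (\<forall>x\<in>carrier_vec m. eval_vec p x = c \<bullet> (\<rho> g *\<^sub>v x))"
      using linear_polynomial[OF T] by auto
  qed
  from bchoice[OF this] obtain L where L: "\<forall>g\<in>G. L g \<in> mpolys {..<m} \<and> total_degree (L g) \<le> 1 \<and>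
      const_term (L g) = 0 \<and> (\<forall>x\<in>carrier_vec m. eval_vec (L g) x = c \<bullet> (\<rho> g *\<^sub>v x))" ..
  define f where "f = (\<Prod>g\<in>G. L g)"
  have eval: "eval_vec f x = (\<Prod>g\<in>G. c \<bullet> (\<rho> g *\<^sub>v x))" if "x \<in> carrier_vec m" for x
    unfolding f_def mpoly_eval_prod using L that by (intro prod.cong) auto
  have fI: "f \<in> mpolys {..<m}"
    unfolding f_def using L by (intro mpolys_prod) auto
  have deg: "total_degree f \<le> card G"
    unfolding f_def using L by (intro total_degree_prod_le) auto
  \<comment> \<open>A single factor without constant term suffices; the one for the identity of
    \<open>G\<close> is taken.\<close>
  have f0: "const_term f = 0"
    unfolding f_def using L one_in_group[OF G] by (intro const_term_prod[OF fin]) auto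
  have "eval_vec f (\<rho> h *\<^sub>v x) = eval_vec f x" if h: "h \<in> G" and x: "x \<in> carrier_vec m" for h x
  proof -
    have hx: "\<rho> h *\<^sub>v x \<in> carrier_vec m" using \<rho>c[OF h] x by (rule mult_mat_vec_carrier)
    \<comment> \<open>Right multiplication by \<open>h\<close> permutes \<open>G\<close>, hence the
      factors of the norm.\<close>
    have bij: "bij_betw (\<lambda>g. g * h) G G"
    proof (rule bij_betw_byWitness[of _ "\<lambda>g. g * inv\<^bsub>GL n\<^esub> h"])
      note hc = group_carrier[OF G h] and ic = inv_carrier[OF G h]
      show "\<forall>g\<in>G. g * h * inv\<^bsub>GL n\<^esub> h = g"
        using hc ic group_inv(1)[OF G h] right_mult_one_mat[OF group_carrier[OF G]]
        by (simp add: assoc_mult_mat[OF group_carrier[OF G]])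
      show "\<forall>g\<in>G. g * inv\<^bsub>GL n\<^esub> h * h = g"
        using hc ic group_inv(2)[OF G h] right_mult_one_mat[OF group_carrier[OF G]]
        by (simp add: assoc_mult_mat[OF group_carrier[OF G]])
      show "(\<lambda>g. g * h) ` G \<subseteq> G" "(\<lambda>g. g * inv\<^bsub>GL n\<^esub> h) ` G \<subseteq> G"
        using h mult_in_group[OF G] inv_in_group[OF G] by auto
    qed
    have "eval_vec f (\<rho> h *\<^sub>v x) = (\<Prod>g\<in>G. c \<bullet> (\<rho> (g * h) *\<^sub>v x))"
      unfolding eval[OF hx]
    proof (rule prod.cong[OF refl])
      fix g assume g: "g \<in> G"
      show "c \<bullet> (\<rho> g *\<^sub>v (\<rho> h *\<^sub>v x)) = c \<bullet> (\<rho> (g * h) *\<^sub>v x)"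
        unfolding \<rho>mult[OF g h] assoc_mult_mat_vec[OF \<rho>c[OF g] \<rho>c[OF h] x] ..
    qed
    also have "\<dots> = eval_vec f x"
      unfolding eval[OF x] by (rule prod.reindex_bij_betw[OF bij])
    finally show ?thesis .
  qed
  then have "f \<in> invariants n G m \<rho>"
    unfolding invariants_def using fI inv_in_group[OF G] by blast
  then have "f \<in> plus_part (invariants_le n G m \<rho> (card G))"
    using deg f0 by (simp add: plus_part_def invariants_le_def)
  moreover have "eval_vec f v \<noteq> 0"
    using eval[of v] v c(2) fin by simp
  ultimately show "\<exists>f\<in>plus_part (invariants_le n G m \<rho> (card G)). eval_vec f v \<noteq> 0" ..
qed

text \<open>The bound \<open>card G\<close> on the degree is the same for all modules, so it passes
  to the supremum.\<close>

lemma sigma_le_card: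
  fixes G :: "'a::field mat set"
  assumes "infinite (UNIV :: 'a set)" "linear_algebraic_group n G" "finite G"
  shows "sigma n G \<le> enat (card G)"
  unfolding sigma_def
proof (rule Sup_least)
  fix e assume "e \<in> {sigma_module n G m \<rho> |m \<rho>. G_module n G m \<rho>}"
  then obtain m \<rho> where e: "e = sigma_module n G m \<rho>" "G_module n G m \<rho>" by blast
  show "e \<le> enat (card G)"
    unfolding e(1) sigma_module_def
    using sigma_set_finite_group[OF assms e(2)] by (intro Inf_lower) blast
qed

theorem corollary1p7:
  fixes n :: nat and G :: "'k::alg_closed_field mat set"
  assumes "reductive_group n G"
  shows "sigma n G < \<infinity> \<longleftrightarrow> finite G"
proof
  have G: "linear_algebraic_group n G"
    using assms by (simp add: reductive_group_def)
  show "sigma n G < \<infinity>" if "finite G"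
  proof -
    have "sigma n G \<le> enat (card G)"
      by (rule sigma_le_card[OF infinite_alg_closed G that])
    also have "\<dots> < \<infinity>" by simp
    finally show ?thesis .
  qed
  show "finite G" if lt: "sigma n G < \<infinity>"
  proof (rule ccontr)
    assume inf: "infinite G"
    obtain d where d: "sigma n G = enat d" using lt by (cases "sigma n G") auto
    \<comment> \<open>With \<open>d\<close> the supposed finite value of \<open>sigma n G\<close>,
      the range \<open>d * d\<close> is the one that separates the weights of monomials of degree at
      most \<open>d\<close> from \<open>1\<close>.\<close>
    obtain g t where g: "g \<in> G" "poly (char_poly g) t = 0"
      and order: "\<forall>k. 0 < k \<and> k \<le> d * d \<longrightarrow> t ^ k \<noteq> 1"
      using eigenvalue_large_order[OF assms inf, of "d * d"] by blast
    have "enat d < sigma_module n G (n + n ^ d) (power_module n d)"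
      using order by (intro sigma_power_module[OF G g]) auto
    also have "\<dots> \<le> sigma n G"
      unfolding sigma_def using G_module_power_module[OF G] by (intro Sup_upper) blast
    finally show False by (simp add: d)
  qed
qed

end
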